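(* Let $\beta>1$, $L>0$, and let $x_0\in B_1=\{x\in\mathbb{R}^2:\|x\|\le 1\}$ be some arbitrary fixed point. Consider observations $Y_i=T_\mu f(\theta_i,s_i)+\epsilon_i$, $i=1,\dots,n$, with $f\in H(\beta,L)$, where $(\theta_i,s_i)$ are i.i.d. random variables on $Z=\mathrm{S}^1\times[-1,1]$. Assume: (B1) the $\epsilon_i$ are i.i.d. with a distribution $G$ satisfying, for some constants $I_0>0$, $v_0>0$, $$\int_{-\infty}^\infty \ln\frac{dG(u)}{dG(u+v)}\,dG(u)\le I_0v^2\quad\text{for }|v|\le v_0;$$ (B2) there is a constant $C_3$ such that every non-negative measurable function $g$ on $Z$ satisfies $$E_{(\theta,s)}\Big[\sum_{i=1}^n g(\theta_i,s_i)\Big]\le C_3\,n\int_Z g(\theta,s)\,ds\,d\theta .$$ Then, with $\psi_n=n^{-\frac{\beta-1}{2\beta+1}}$, $$\liminf_{n\to\infty}\ \inf_{\hat f_n}\ \sup_{f\in H(\beta,L)}\psi_n^{-2}\,\mathrm{MSE}(\hat f_n,f)\ge c_0,\qquad \mathrm{MSE}(\hat f_n,f)=E_f\big[|\hat f_n(x_0)-f(x_0)|^2\big],$$ where $\inf_{\hat f_n}$ is the infimum over all estimators $\hat f_n$ based on the data $(\theta_i,s_i,Y_i)_{i=1}^n$ and $c_0>0$ is some constant.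
   Context: Function class: for $\beta>1$ and $L>0$, $H(\beta,L)$ is the class of functions $f:\mathbb{R}^2\to\mathbb{R}$ supported in the closed unit ball $B_1$ whose Fourier transform $\widetilde f(\xi)=\int_{\mathbb{R}^2}f(x)e^{-i\xi\cdot x}dx$ satisfies $\int_{\mathbb{R}^2}(1+\|\xi\|^2)^\beta|\widetilde f(\xi)|^2d\xi\le L$; since $\beta>1$, $f$ is taken to be its continuous representative. Exponential Radon transform: $\mu$ is a fixed real constant. For $\theta\in\mathrm{S}^1$ (the unit circle in $\mathbb{R}^2$), $\theta^\perp$ is the unit vector perpendicular to $\theta$, with a fixed orientation (rotation of $\theta$ by $\pi/2$). For $(\theta,s)\in Z=\mathrm{S}^1\times[-1,1]$, $$T_\mu f(\theta,s)=\int_{x\cdot\theta=s}e^{\mu x\cdot\theta^\perp}f(x)\,dx,$$ with $dx$ arc length on the line $\{x: x\cdot\theta=s\}$. Errors: the $\epsilon_i$ are real random variables with mean $0$ and finite variance $\sigma^2>0$. In (B1), $dG(u+v)$ denotes the distribution $G$ translated by $v$ (the law of $\epsilon-v$ for $\epsilon\sim G$), and the integral is the Kullback distance $\int\ln\frac{dP}{dQ}dP$ ($+\infty$ if $P$ is not absolutely continuous with respect to $Q$) between $P=G$ and this translate $Q$. $E_{(\theta,s)}$ is expectation over the design points; $E_f$ is expectation with respect to the joint distribution of $(\theta_i,s_i,Y_i)$, $i=1,\dots,n$, when the true function is $f$.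
   Formalization: The point x_0 is taken with ||x_0|| < 1 instead of ||x_0|| <= 1: every f in H(beta,L) is continuous and supported in B_1, so f(x_0) = 0 when ||x_0|| = 1, the zero estimator has no error there, and the claimed lower bound fails. *)

theory Defs
  imports "HOL-Probability.Probability"
begin

definition fourier :: "(real^2 \<Rightarrow> real) \<Rightarrow> real^2 \<Rightarrow> complex" where
  "fourier f \<xi> = (\<integral>x. complex_of_real (f x) * exp (- \<i> * complex_of_real (\<xi> \<bullet> x)) \<partial>lborel)"

definition sobolev_class :: "real \<Rightarrow> real \<Rightarrow> (real^2 \<Rightarrow> real) set" where
  "sobolev_class \<beta> L = {f. continuous_on UNIV f \<and> (\<forall>x. x \<notin> cball 0 1 \<longrightarrow> f x = 0) \<and>
     (\<integral>\<^sup>+\<xi>. ennreal ((1 + (norm \<xi>)\<^sup>2) powr \<beta> * (cmod (fourier f \<xi>))\<^sup>2) \<partial>lborel) \<le> ennreal L}"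

text \<open>
  Members of the class are continuous on the whole plane and vanish off the closed unit
  disc, so they vanish on the unit circle as well.  At a point of the unit circle the constant
  estimator zero therefore has no error, and no positive lower bound on the pointwise risk
  is possible there: the point of estimation has to be interior to the disc.
\<close>

lemma sobolev_class_zero_on_circle:
  assumes "f \<in> sobolev_class \<beta> L" and "norm x = 1"
  shows "f x = 0"
proof -
  have cont: "continuous_on UNIV f" and zero: "\<And>y. norm y > 1 \<Longrightarrow> f y = 0"
    using assms(1) by (auto simp: sobolev_class_def)
  have "((\<lambda>t. f (t *\<^sub>R x)) \<longlongrightarrow> f (1 *\<^sub>R x)) (at_right 1)"
    by (intro isCont_tendsto_compose[where g = f] tendsto_intros)
      (use cont in \<open>simp add: continuous_on_eq_continuous_at\<close>)
  moreover have "((\<lambda>t. f (t *\<^sub>R x)) \<longlongrightarrow> 0) (at_right 1)"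
    by (rule tendsto_eventually)
      (auto simp: eventually_at_filter assms(2) intro!: always_eventually zero)
  ultimately show ?thesis
    using tendsto_unique[of "at_right (1::real)"] by fastforce
qed

definition perp :: "real^2 \<Rightarrow> real^2" where
  "perp \<theta> = vector [- (\<theta> $ 2), \<theta> $ 1]"

text \<open>
  For a unit vector \<open>\<theta>\<close>, the map \<open>t \<mapsto> s \<theta> + t \<theta>\<^sup>\<bottom>\<close> parametrizes the line
  \<open>x \<bullet> \<theta> = s\<close> by arc length.
\<close>

definition exp_radon :: "real \<Rightarrow> (real^2 \<Rightarrow> real) \<Rightarrow> (real^2) \<times> real \<Rightarrow> real" where
  "exp_radon \<mu> f = (\<lambda>(\<theta>, s).
     \<integral>t. (let x = s *\<^sub>R \<theta> + t *\<^sub>R perp \<theta> in exp (\<mu> * (x \<bullet> perp \<theta>)) * f x) \<partial>lborel)"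

text \<open>Arc length on the unit circle, and \<open>d\<theta> ds\<close> on \<open>Z\<close> with its Borel sets.\<close>

definition circle_measure :: "(real^2) measure" where
  "circle_measure = distr (restrict_space lborel {0..<2 * pi})
     (restrict_space borel (sphere 0 1)) (\<lambda>\<phi>. vector [cos \<phi>, sin \<phi>])"

definition Z_measure :: "((real^2) \<times> real) measure" where
  "Z_measure = circle_measure \<Otimes>\<^sub>M restrict_space lborel {-1..1}"

text \<open>
  The Kullback distance \<open>\<integral> ln (dP/dQ) dP\<close> of probability measures.  If \<open>P\<close> is absolutely
  continuous with respect to \<open>Q\<close>, the negative part of the integrand is always integrable,
  so non-integrability means that the integral is \<open>\<infinity>\<close>; the Bochner integral would be 0 then.
\<close>

definition kullback :: "'a measure \<Rightarrow> 'a measure \<Rightarrow> ereal" where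
  "kullback P Q =
     (if absolutely_continuous Q P \<and> integrable P (entropy_density (exp 1) Q P)
      then ereal (KL_divergence (exp 1) Q P) else \<infinity>)"

definition iid :: "'a measure \<Rightarrow> 'b measure \<Rightarrow> (nat \<Rightarrow> 'a \<Rightarrow> 'b) \<Rightarrow> bool" where
  "iid M N X \<longleftrightarrow> prob_space.indep_vars M (\<lambda>_. N) X UNIV \<and>
     (\<forall>i j. distr M N (X i) = distr M N (X j))"

text \<open>
  Independence of two sequences, i.e. of the sigma-algebras they generate
  (\<^const>\<open>prob_space.indep_var\<close> only covers two variables of the same type).
\<close>

definition indep_sequences ::
  "'a measure \<Rightarrow> 'b measure \<Rightarrow> (nat \<Rightarrow> 'a \<Rightarrow> 'b) \<Rightarrow> 'c measure \<Rightarrow> (nat \<Rightarrow> 'a \<Rightarrow> 'c) \<Rightarrow> bool" where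
  "indep_sequences M N X N' Y \<longleftrightarrow> prob_space.indep_set M
     (sets (vimage_algebra (space M) (\<lambda>\<omega> i. X i \<omega>) (\<Pi>\<^sub>M i\<in>UNIV. N)))
     (sets (vimage_algebra (space M) (\<lambda>\<omega> i. Y i \<omega>) (\<Pi>\<^sub>M i\<in>UNIV. N')))"

text \<open>
  The observations are indexed by \<open>0, \<dots>, n - 1\<close>; an estimator of the value at a point is a
  real-valued measurable function of the sample.
\<close>

type_synonym sample = "nat \<Rightarrow> ((real^2) \<times> real) \<times> real"

definition estimators :: "nat \<Rightarrow> (sample \<Rightarrow> real) set" where
  "estimators n = borel_measurable (\<Pi>\<^sub>M i\<in>{..<n}. Z_measure \<Otimes>\<^sub>M borel)"

definition sample_of :: "real \<Rightarrow> (nat \<Rightarrow> 'a \<Rightarrow> (real^2) \<times> real) \<Rightarrow> (nat \<Rightarrow> 'a \<Rightarrow> real) \<Rightarrow>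
    (real^2 \<Rightarrow> real) \<Rightarrow> nat \<Rightarrow> 'a \<Rightarrow> sample" where
  "sample_of \<mu> X \<epsilon> f n \<omega> = (\<lambda>i\<in>{..<n}. (X i \<omega>, exp_radon \<mu> f (X i \<omega>) + \<epsilon> i \<omega>))"

definition MSE :: "'a measure \<Rightarrow> real \<Rightarrow> (nat \<Rightarrow> 'a \<Rightarrow> (real^2) \<times> real) \<Rightarrow> (nat \<Rightarrow> 'a \<Rightarrow> real) \<Rightarrow>
    real^2 \<Rightarrow> nat \<Rightarrow> (sample \<Rightarrow> real) \<Rightarrow> (real^2 \<Rightarrow> real) \<Rightarrow> ennreal" where
  "MSE M \<mu> X \<epsilon> x0 n est f =
     (\<integral>\<^sup>+\<omega>. ennreal (\<bar>est (sample_of \<mu> X \<epsilon> f n \<omega>) - f x0\<bar>\<^sup>2) \<partial>M)"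

definition rate :: "real \<Rightarrow> nat \<Rightarrow> real" where
  "rate \<beta> n = real n powr (- ((\<beta> - 1) / (2 * \<beta> + 1)))"

end

theory Submission
  imports Defs
begin

text \<open>
  Two hypotheses, the zero function and a bump of width \<open>h = n powr (-1 / (2 * \<beta> + 1))\<close> and height
  of order \<open>h powr (\<beta> - 1)\<close> at the point of estimation, are compared conditionally on the design.
  The transform of the bump is of order \<open>h powr \<beta>\<close> on a strip of \<open>Z\<close> of area of order \<open>h\<close>, so by
  (B1) and (B2) the expected conditional Kullback distance is of order
  \<open>n * h powr (2 * \<beta> + 1) = 1\<close>, with a small factor when the bump is small.  A Kullback distance \<open>K\<close>
  forces the Hellinger affinity to be at least \<open>1 - K / 2\<close>, and then no estimator can be accurate
  under both hypotheses.

  The bump is a product of B-splines.  Their Fourier transforms are powers of the transform of the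
  indicator of \<open>[-1, 1]\<close>, so a large order gives the decay required by the Sobolev condition for any
  real \<open>\<beta>\<close>.
\<close>

section \<open>Two-point bounds\<close>

text \<open>Under (B2) the design is controlled only in mean, so the Kullback distance given the
  design is a random quantity of which nothing but the expectation is bounded. The two-point bound
  is therefore shaped to be affine in it: for target values at distance \<open>D\<close> and
  conditional distance \<open>K\<close>, the sum of the two risks is at least
  \<open>D^2 / 2 * (1 - K)\<close>. Averaging over the design then needs only the mean of
  \<open>K\<close>, and no atypical design has to be cut away. The affinity serves this purpose
  because it multiplies over independent errors and is linked to \<open>K\<close> by
  \<open>ln y \<le> y - 1\<close> alone. The class is defined on the Fourier side with a real
  exponent, while its members must have compact support; the bump thus needs both a bounded support
  and an explicit decay of its transform. The height is what the Sobolev norm allows under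
  rescaling, and the transform gains one more factor \<open>h\<close> because a line meets the
  support of the bump in length of order \<open>h\<close>. A free small factor in the height meets
  all remaining constraints at once: membership in the class, the range of (B1), and a mean Kullback
  distance of at most 1/2.\<close>

lemma prod_one_minus_ge:
  fixes a :: "'i \<Rightarrow> real"
  assumes "finite I" "\<And>i. i \<in> I \<Longrightarrow> 0 \<le> a i \<and> a i \<le> 1"
  shows "1 - (\<Sum>i\<in>I. a i) \<le> (\<Prod>i\<in>I. 1 - a i)"
  using assms
proof (induction I)
  case (insert j I)
  have "0 \<le> (\<Prod>i\<in>I. 1 - a i)" "(\<Prod>i\<in>I. 1 - a i) \<le> 1"
    using insert.prems by (auto intro!: prod_nonneg prod_le_1)
  moreover have "1 - (\<Sum>i\<in>I. a i) \<le> (\<Prod>i\<in>I. 1 - a i)"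
    using insert by auto
  moreover have "a j * (\<Prod>i\<in>I. 1 - a i) \<le> a j * 1"
    using insert.prems calculation by (intro mult_left_mono) auto
  ultimately show ?case
    using insert by (simp add: algebra_simps)
qed simp

text \<open>With \<open>r\<close> the density of \<open>P\<close> with respect to \<open>Q\<close>,
  the inequality \<open>ln y \<le> y - 1\<close> at \<open>y = 1 / sqrt r\<close> reads
  \<open>1 - ln r / 2 \<le> 1 / sqrt r\<close>. Integrated over \<open>P\<close>, the left side
  becomes one minus half the Kullback distance and the right side the affinity. The density is part
  of the conclusion because likelihood ratios of products are built from it.\<close>

lemma kullback_hellinger:
  assumes P: "prob_space P" and Q: "prob_space Q" and sets: "sets P = sets Q"
    and kl: "kullback P Q \<le> ereal K"
  obtains r :: "'a \<Rightarrow> real" where "r \<in> borel_measurable Q" "\<And>x. 0 \<le> r x"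
    "P = density Q (\<lambda>x. ennreal (r x))"
    "ennreal (1 - K / 2) \<le> (\<integral>\<^sup>+x. ennreal (sqrt (r x)) \<partial>Q)"
proof -
  interpret P: prob_space P by fact
  interpret Q: prob_space Q by fact
  from kl have ac: "absolutely_continuous Q P"
    and int: "integrable P (entropy_density (exp 1) Q P)"
    and le: "(\<integral>x. entropy_density (exp 1) Q P x \<partial>P) \<le> K"
    by (auto simp: kullback_def KL_divergence_def split: if_splits)
  define r where "r x = enn2real (RN_deriv Q P x)" for x
  have r[measurable]: "r \<in> borel_measurable Q"
    unfolding r_def by measurable
  have nonneg: "0 \<le> r x" for x
    by (simp add: r_def)
  have fin: "AE x in Q. RN_deriv Q P x \<noteq> \<infinity>"
    using ac sets P.sigma_finite_measure by (intro Q.RN_deriv_finite) auto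
  have dens: "P = density Q (\<lambda>x. ennreal (r x))"
  proof -
    have "P = density Q (RN_deriv Q P)"
      using Q.density_RN_deriv[OF ac sets] by simp
    also have "\<dots> = density Q (\<lambda>x. ennreal (r x))"
      using fin by (intro density_cong) (auto simp: r_def less_top[symmetric])
    finally show ?thesis .
  qed
  have pos: "AE x in P. 0 < r x"
    by (subst dens) (auto simp: AE_density)
  have ed: "entropy_density (exp 1) Q P = (\<lambda>x. ln (r x))"
    by (auto simp: entropy_density_def r_def log_def)
  define g where "g x = 1 - ln (r x) / 2" for x
  have g: "integrable P g"
    unfolding g_def using int unfolding ed by (intro Bochner_Integration.integrable_diff) auto
  have "1 - K / 2 \<le> (\<integral>x. g x \<partial>P)"
    using le int P.prob_space by (simp add: ed g_def)
  \<comment> \<open>The positive part makes the comparison with \<open>1 / sqrt (r x)\<close> one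
    between nonnegative integrals, so that no integrability of the larger function has to be
    established.\<close>
  also have "\<dots> \<le> (\<integral>x. max 0 (g x) \<partial>P)"
    using g by (intro integral_mono integrable_max) auto
  finally have "ennreal (1 - K / 2) \<le> ennreal (\<integral>x. max 0 (g x) \<partial>P)"
    by (rule ennreal_leI)
  also have "\<dots> = (\<integral>\<^sup>+x. ennreal (max 0 (g x)) \<partial>P)"
    using g by (intro nn_integral_eq_integral[symmetric] integrable_max) auto
  also have "\<dots> \<le> (\<integral>\<^sup>+x. ennreal (1 / sqrt (r x)) \<partial>P)"
  proof (rule nn_integral_mono_AE, use pos in eventually_elim)
    fix x assume "0 < r x"
    then have "ln (1 / sqrt (r x)) \<le> 1 / sqrt (r x) - 1"
      by (intro ln_le_minus_one) auto
    with \<open>0 < r x\<close> show "ennreal (max 0 (g x)) \<le> ennreal (1 / sqrt (r x))"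
      by (intro ennreal_leI) (auto simp: g_def ln_div ln_sqrt)
  qed
  also have "\<dots> = (\<integral>\<^sup>+x. ennreal (r x) * ennreal (1 / sqrt (r x)) \<partial>Q)"
    by (subst dens, subst nn_integral_density) auto
  \<comment> \<open>Where \<open>r x = 0\<close> the quotient \<open>1 / sqrt (r x)\<close> is 0 by
    convention, so the identity holds at every point.\<close>
  also have "\<dots> = (\<integral>\<^sup>+x. ennreal (sqrt (r x)) \<partial>Q)"
  proof (rule nn_integral_cong)
    fix x
    show "ennreal (r x) * ennreal (1 / sqrt (r x)) = ennreal (sqrt (r x))"
      using nonneg[of x] real_div_sqrt[of "r x"] by (simp flip: ennreal_mult)
  qed
  finally show ?thesis
    using that r nonneg dens by blast
qed

lemma sqrt_prod: "sqrt (\<Prod>i\<in>I. f i) = (\<Prod>i\<in>I. sqrt (f i))"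
  by (induction I rule: infinite_finite_induct) (auto simp: real_sqrt_mult)

lemma PiM_density:
  assumes I: "finite I" and Q: "\<And>i. sigma_finite_measure (Q i)"
    and r[measurable]: "\<And>i. i \<in> I \<Longrightarrow> r i \<in> borel_measurable (Q i)"
    and P: "\<And>i. sigma_finite_measure (P i)" "\<And>i. i \<in> I \<Longrightarrow> P i = density (Q i) (r i)"
  shows "(\<Pi>\<^sub>M i\<in>I. P i) = density (\<Pi>\<^sub>M i\<in>I. Q i) (\<lambda>x. \<Prod>i\<in>I. r i (x i))"
proof -
  interpret Q: product_sigma_finite Q by (simp add: product_sigma_finite_def Q)
  interpret P: product_sigma_finite P by (simp add: product_sigma_finite_def P)
  have sets: "sets (\<Pi>\<^sub>M i\<in>I. Q i) = sets (\<Pi>\<^sub>M i\<in>I. P i)"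
    using P(2) by (intro sets_PiM_cong) auto
  show ?thesis
  proof (rule P.PiM_eqI[symmetric, OF I])
    fix A assume A: "\<And>i. i \<in> I \<Longrightarrow> A i \<in> sets (P i)"
    have A'[measurable]: "\<And>i. i \<in> I \<Longrightarrow> A i \<in> sets (Q i)"
      using A P(2) by auto
    have "emeasure (density (\<Pi>\<^sub>M i\<in>I. Q i) (\<lambda>x. \<Prod>i\<in>I. r i (x i))) (Pi\<^sub>E I A)
       = (\<integral>\<^sup>+x. (\<Prod>i\<in>I. r i (x i)) * indicator (Pi\<^sub>E I A) x \<partial>(\<Pi>\<^sub>M i\<in>I. Q i))"
      using I by (intro emeasure_density sets_PiM_I_finite A') measurable
    also have "\<dots> = (\<integral>\<^sup>+x. (\<Prod>i\<in>I. r i (x i) * indicator (A i) (x i)) \<partial>(\<Pi>\<^sub>M i\<in>I. Q i))"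
    proof (rule nn_integral_cong)
      fix x assume "x \<in> space (\<Pi>\<^sub>M i\<in>I. Q i)"
      then have "indicator (Pi\<^sub>E I A) x = (\<Prod>i\<in>I. indicator (A i) (x i) :: ennreal)"
        using I by (auto simp: indicator_def PiE_iff space_PiM prod_eq_1_iff intro: prod_zero[symmetric])
      then show "(\<Prod>i\<in>I. r i (x i)) * indicator (Pi\<^sub>E I A) x = (\<Prod>i\<in>I. r i (x i) * indicator (A i) (x i))"
        by (simp add: prod.distrib)
    qed
    also have "\<dots> = (\<Prod>i\<in>I. \<integral>\<^sup>+x. r i x * indicator (A i) x \<partial>Q i)"
      using I by (intro Q.product_nn_integral_prod) auto
    also have "\<dots> = (\<Prod>i\<in>I. emeasure (P i) (A i))"
      using P(2) by (intro prod.cong) (auto simp: emeasure_density)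
    finally show "emeasure (density (\<Pi>\<^sub>M i\<in>I. Q i) (\<lambda>x. \<Prod>i\<in>I. r i (x i))) (Pi\<^sub>E I A) =
      (\<Prod>i\<in>I. emeasure (P i) (A i))" .
  qed (simp add: sets)
qed

text \<open>The gap is at most the sum of the two errors; multiplying by the gap times
  \<open>sqrt p\<close> gives two products, each split by the arithmetic-geometric mean inequality.
  When \<open>p\<close> is the likelihood ratio of the first law and the inequality is integrated
  over the second, the left side becomes the squared gap times the affinity, the next two terms
  become the risks, and the last becomes half the squared gap, as \<open>p\<close> and 1 both
  integrate to one.\<close>

lemma two_point_pointwise:
  fixes a0 a1 t p :: real
  assumes "0 \<le> p"
  shows "(a1 - a0)\<^sup>2 * sqrt p \<le> p * (t - a0)\<^sup>2 + (t - a1)\<^sup>2 + (a1 - a0)\<^sup>2 / 4 * (p + 1)"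
proof -
  define q D x y where "q = sqrt p" and "D = \<bar>a1 - a0\<bar>" and "x = \<bar>t - a0\<bar>" and "y = \<bar>t - a1\<bar>"
  have q: "0 \<le> q" "p = q\<^sup>2" using assms by (auto simp: q_def)
  have "D \<le> x + y" "0 \<le> D" by (auto simp: D_def x_def y_def)
  then have "D * (D * q) \<le> (x + y) * (D * q)"
    using q by (intro mult_right_mono) auto
  then have "D\<^sup>2 * q \<le> q * x * D + y * (q * D)"
    by (simp add: power2_eq_square algebra_simps)
  also have "q * x * D \<le> (q * x)\<^sup>2 + (D / 2)\<^sup>2"
    using sum_squares_bound[of "q * x" "D / 2"] by (simp add: mult_ac)
  also have "y * (q * D) \<le> y\<^sup>2 + (q * D / 2)\<^sup>2"
    using sum_squares_bound[of y "q * D / 2"] by (simp add: mult_ac)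
  finally have "D\<^sup>2 * q \<le> q\<^sup>2 * x\<^sup>2 + y\<^sup>2 + D\<^sup>2 / 4 * (q\<^sup>2 + 1)"
    by (simp add: power_mult_distrib power_divide field_simps)
  then show ?thesis
    by (simp only: D_def x_def y_def power2_abs q_def[symmetric] q(2)[symmetric])
qed

text \<open>This is the situation for a fixed design: the data are \<open>e\<close> under the zero
  function and \<open>e + w\<close> under the alternative. The law of \<open>e + w\<close> serves as
  reference measure, so the second risk carries no weight and the first carries the likelihood
  ratio.\<close>

lemma two_point_bound:
  fixes G :: "real measure" and w K :: "'i \<Rightarrow> real"
  assumes G: "prob_space G" "sets G = sets borel" and I: "finite I"
    and kl: "\<And>i. i \<in> I \<Longrightarrow> kullback G (distr G borel (\<lambda>u. u + w i)) \<le> ereal (K i)"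
    and K: "\<And>i. i \<in> I \<Longrightarrow> 0 \<le> K i"
    and T[measurable]: "T \<in> borel_measurable (\<Pi>\<^sub>M i\<in>I. borel)"
  shows "ennreal ((a1 - a0)\<^sup>2 / 2 * (1 - (\<Sum>i\<in>I. K i))) \<le>
    (\<integral>\<^sup>+e. ennreal ((T e - a0)\<^sup>2) \<partial>(\<Pi>\<^sub>M i\<in>I. G)) +
    (\<integral>\<^sup>+e. ennreal ((T (\<lambda>i\<in>I. e i + w i) - a1)\<^sup>2) \<partial>(\<Pi>\<^sub>M i\<in>I. G))"
    (is "_ \<le> ?M0 + ?M1")
\<comment> \<open>If the sum exceeds 1, the left side is \<open>ennreal\<close> of a nonpositive
  number, hence 0. Otherwise each \<open>K i\<close> is at most 1, which keeps all factors
  \<open>1 - K i / 2\<close> nonnegative.\<close>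
proof (cases "(\<Sum>i\<in>I. K i) \<le> 1")
  case False
  then have "(a1 - a0)\<^sup>2 / 2 * (1 - (\<Sum>i\<in>I. K i)) \<le> 0"
    by (intro mult_nonneg_nonpos) auto
  then show ?thesis by (simp add: ennreal_neg)
next
  case True
  interpret G: prob_space G by fact
  note [measurable_cong] = G(2)
  define Q where "Q i = distr G borel (\<lambda>u. u + w i)" for i
  have sQ[measurable_cong, simp]: "sets (Q i) = sets borel" for i by (simp add: Q_def)
  have Q: "prob_space (Q i)" for i
    unfolding Q_def by (rule G.prob_space_distr) measurable
  interpret Q: prob_space "Q i" for i by (rule Q)
  interpret QP: product_sigma_finite Q by standard
  interpret PQ: product_prob_space Q I by standard
  have PQ1: "emeasure (Pi\<^sub>M I Q) (space (Pi\<^sub>M I Q)) = 1"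
    by (rule PQ.emeasure_space_1)
  have "\<exists>r. r \<in> borel_measurable borel \<and> (\<forall>x. 0 \<le> r x) \<and> G = density (Q i) (\<lambda>x. ennreal (r x)) \<and>
     ennreal (1 - K i / 2) \<le> (\<integral>\<^sup>+x. ennreal (sqrt (r x)) \<partial>Q i)" if "i \<in> I" for i
  proof -
    have "sets G = sets (Q i)" using G(2) by simp
    from kullback_hellinger[OF G(1) Q this kl[OF that, folded Q_def]] obtain r where
      "r \<in> borel_measurable (Q i)" "\<And>x. 0 \<le> r x" "G = density (Q i) (\<lambda>x. ennreal (r x))"
      "ennreal (1 - K i / 2) \<le> (\<integral>\<^sup>+x. ennreal (sqrt (r x)) \<partial>Q i)" by blast
    then show ?thesis by (intro exI[of _ r]) (auto cong: measurable_cong_sets)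
  qed
  then obtain r :: "'i \<Rightarrow> real \<Rightarrow> real" where
    r[measurable]: "\<And>i. i \<in> I \<Longrightarrow> r i \<in> borel_measurable borel"
    and r0: "\<And>i x. i \<in> I \<Longrightarrow> 0 \<le> r i x"
    and rG: "\<And>i. i \<in> I \<Longrightarrow> G = density (Q i) (\<lambda>x. ennreal (r i x))"
    and rho: "\<And>i. i \<in> I \<Longrightarrow> ennreal (1 - K i / 2) \<le> (\<integral>\<^sup>+x. ennreal (sqrt (r i x)) \<partial>Q i)"
    by metis
  define p where "p x = (\<Prod>i\<in>I. r i (x i))" for x
  have p0: "0 \<le> p x" for x unfolding p_def by (intro prod_nonneg ballI r0)
  have p[measurable]: "p \<in> borel_measurable (Pi\<^sub>M I Q)"
    unfolding p_def by measurable
  have PG: "(\<Pi>\<^sub>M i\<in>I. G) = density (Pi\<^sub>M I Q) (\<lambda>x. ennreal (p x))"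
    using PiM_density[of I Q "\<lambda>i x. ennreal (r i x)" "\<lambda>_. G", OF I] rG r0
    by (simp add: Q.sigma_finite_measure_axioms G.sigma_finite_measure_axioms p_def prod_ennreal)
  have M0: "?M0 = (\<integral>\<^sup>+y. ennreal (p y) * ennreal ((T y - a0)\<^sup>2) \<partial>Pi\<^sub>M I Q)"
    by (subst PG, subst nn_integral_density) auto
  have "distr (\<Pi>\<^sub>M i\<in>I. G) (Pi\<^sub>M I Q) (\<lambda>e. \<lambda>i\<in>I. e i + w i) = Pi\<^sub>M I Q"
  proof (rule QP.PiM_eqI[OF I])
    interpret GP: product_sigma_finite "\<lambda>_::'i. G" by standard
    fix A assume A: "\<And>i. i \<in> I \<Longrightarrow> A i \<in> sets (Q i)"
    have [measurable]: "Pi\<^sub>E I A \<in> sets (Pi\<^sub>M I Q)" using A I by (intro sets_PiM_I_finite) auto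
    have "emeasure (distr (\<Pi>\<^sub>M i\<in>I. G) (Pi\<^sub>M I Q) (\<lambda>e. \<lambda>i\<in>I. e i + w i)) (Pi\<^sub>E I A) =
      emeasure (\<Pi>\<^sub>M i\<in>I. G) (\<Pi>\<^sub>E i\<in>I. (\<lambda>u. u + w i) -` A i \<inter> space G)"
      by (subst emeasure_distr) (auto intro!: arg_cong[where f="emeasure _"] simp: space_PiM PiE_iff)
    also have "\<dots> = (\<Prod>i\<in>I. emeasure G ((\<lambda>u. u + w i) -` A i \<inter> space G))"
      using A I by (intro GP.emeasure_PiM) (auto intro!: measurable_sets[where A=borel])
    also have "\<dots> = (\<Prod>i\<in>I. emeasure (Q i) (A i))"
      using A unfolding Q_def by (intro prod.cong refl emeasure_distr[symmetric]) auto
    finally show "emeasure (distr (\<Pi>\<^sub>M i\<in>I. G) (Pi\<^sub>M I Q) (\<lambda>e. \<lambda>i\<in>I. e i + w i)) (Pi\<^sub>E I A) =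
      (\<Prod>i\<in>I. emeasure (Q i) (A i))" .
  qed simp
  note shift = this
  have M1: "?M1 = (\<integral>\<^sup>+y. ennreal ((T y - a1)\<^sup>2) \<partial>Pi\<^sub>M I Q)"
    by (subst shift[symmetric], subst nn_integral_distr) measurable
  have K2: "0 \<le> K i / 2 \<and> K i / 2 \<le> 1" if "i \<in> I" for i
  proof -
    have "K i \<le> (\<Sum>i\<in>I. K i)" by (intro member_le_sum that I K) auto
    with K[OF that] True show ?thesis by auto
  qed
  \<comment> \<open>The affinity of product laws is the product of the affinities; the Weierstrass
    product inequality then reduces the bound to the sum of the \<open>K i\<close>.\<close>
  have "ennreal (1 - (\<Sum>i\<in>I. K i) / 2) \<le> ennreal (\<Prod>i\<in>I. 1 - K i / 2)"
    unfolding sum_divide_distrib by (intro ennreal_leI prod_one_minus_ge I K2)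
  also have "\<dots> = (\<Prod>i\<in>I. ennreal (1 - K i / 2))"
    using K2 by (intro prod_ennreal[symmetric]) auto
  also have "\<dots> \<le> (\<Prod>i\<in>I. \<integral>\<^sup>+x. ennreal (sqrt (r i x)) \<partial>Q i)"
    by (intro prod_mono_ennreal rho)
  also have "\<dots> = (\<integral>\<^sup>+y. (\<Prod>i\<in>I. ennreal (sqrt (r i (y i)))) \<partial>Pi\<^sub>M I Q)"
    using I by (intro QP.product_nn_integral_prod[symmetric]) auto
  also have "\<dots> = (\<integral>\<^sup>+y. ennreal (sqrt (p y)) \<partial>Pi\<^sub>M I Q)"
    using r0 by (auto simp: p_def sqrt_prod prod_ennreal intro!: nn_integral_cong)
  finally have affinity: "ennreal (1 - (\<Sum>i\<in>I. K i) / 2) \<le> (\<integral>\<^sup>+y. ennreal (sqrt (p y)) \<partial>Pi\<^sub>M I Q)" .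
  have "ennreal ((a1 - a0)\<^sup>2 * (1 - (\<Sum>i\<in>I. K i) / 2)) =
      ennreal ((a1 - a0)\<^sup>2) * ennreal (1 - (\<Sum>i\<in>I. K i) / 2)"
    by (rule ennreal_mult') simp
  also have "\<dots> \<le> ennreal ((a1 - a0)\<^sup>2) * (\<integral>\<^sup>+y. ennreal (sqrt (p y)) \<partial>Pi\<^sub>M I Q)"
    by (intro mult_left_mono affinity) simp
  also have "\<dots> =
      (\<integral>\<^sup>+y. ennreal ((a1 - a0)\<^sup>2 * sqrt (p y)) \<partial>Pi\<^sub>M I Q)"
    by (simp add: nn_integral_cmult ennreal_mult' p0)
  also have "\<dots> \<le> (\<integral>\<^sup>+y. ennreal (p y) * ennreal ((T y - a0)\<^sup>2) + ennreal ((T y - a1)\<^sup>2) +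
      ennreal ((a1 - a0)\<^sup>2 / 4) * (ennreal (p y) + 1) \<partial>Pi\<^sub>M I Q)"
  proof (rule nn_integral_mono)
    fix y
    show "ennreal ((a1 - a0)\<^sup>2 * sqrt (p y)) \<le> ennreal (p y) * ennreal ((T y - a0)\<^sup>2) +
      ennreal ((T y - a1)\<^sup>2) + ennreal ((a1 - a0)\<^sup>2 / 4) * (ennreal (p y) + 1)"
      using ennreal_leI[OF two_point_pointwise[OF p0, of a1 a0 y "T y"]] p0[of y]
      by (simp add: ennreal_mult[symmetric] ennreal_plus[symmetric] ennreal_1[symmetric]
          del: ennreal_1 ennreal_plus)
  qed
  also have "\<dots> = ?M0 + ?M1 + ennreal ((a1 - a0)\<^sup>2 / 4) * (1 + 1)"
  proof -
    interpret PG: product_prob_space "\<lambda>_::'i. G" I by standard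
    have "(\<integral>\<^sup>+y. ennreal (p y) \<partial>Pi\<^sub>M I Q) = (\<integral>\<^sup>+y. 1 \<partial>(\<Pi>\<^sub>M i\<in>I. G))"
      by (subst PG, subst nn_integral_density) auto
    also have "\<dots> = 1"
      using PG.emeasure_space_1 by simp
    finally show ?thesis
      using PQ1 by (simp add: nn_integral_add nn_integral_cmult M0 M1)
  qed
  also have "ennreal ((a1 - a0)\<^sup>2 / 4) * (1 + 1) = ennreal ((a1 - a0)\<^sup>2 / 2)"
  proof -
    have "(1 + 1 :: ennreal) = ennreal 2" by simp
    then show ?thesis by (simp only:) (subst ennreal_mult'[symmetric], auto)
  qed
  finally have *: "ennreal ((a1 - a0)\<^sup>2 * (1 - (\<Sum>i\<in>I. K i) / 2)) \<le>
     ?M0 + ?M1 + ennreal ((a1 - a0)\<^sup>2 / 2)" .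
  \<comment> \<open>Half the squared gap is finite and can be subtracted, which turns the factor
    \<open>1 - S / 2\<close> into \<open>(1 - S) / 2\<close>, with \<open>S\<close> the sum of the
    \<open>K i\<close>.\<close>
  have "ennreal ((a1 - a0)\<^sup>2 / 2 * (1 - (\<Sum>i\<in>I. K i))) =
     ennreal ((a1 - a0)\<^sup>2 * (1 - (\<Sum>i\<in>I. K i) / 2)) - ennreal ((a1 - a0)\<^sup>2 / 2)"
    by (subst ennreal_minus) (auto simp: algebra_simps diff_divide_distrib)
  also have "\<dots> \<le> ?M0 + ?M1"
    using * by (simp add: ennreal_minus_le_iff add.commute)
  finally show ?thesis .
qed

section \<open>Averaging over a random design\<close>

text \<open>Finitely many coordinates are measurable functions of the whole sequence, so
  independence of the generated sigma-algebras passes to the two vectors. The law of the design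
  vector is left as an image measure; only the errors are resolved into a power of
  \<open>G\<close>.\<close>

lemma distr_independent_sequences:
  assumes M: "prob_space M" and X[measurable]: "\<And>i. X i \<in> measurable M N"
    and errors: "iid M N' Y" "\<And>i. distr M N' (Y i) = G"
    and indep: "indep_sequences M N X N' Y" and n: "0 < n"
  shows "distr M ((\<Pi>\<^sub>M i\<in>{..<n}. N) \<Otimes>\<^sub>M (\<Pi>\<^sub>M i\<in>{..<n}. N'))
      (\<lambda>\<omega>. (\<lambda>i\<in>{..<n}. X i \<omega>, \<lambda>i\<in>{..<n}. Y i \<omega>)) =
    distr M (\<Pi>\<^sub>M i\<in>{..<n}. N) (\<lambda>\<omega>. \<lambda>i\<in>{..<n}. X i \<omega>) \<Otimes>\<^sub>M (\<Pi>\<^sub>M i\<in>{..<n}. G)"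
proof -
  interpret prob_space M by fact
  have iv: "indep_vars (\<lambda>_. N') Y UNIV"
    using errors(1) by (simp add: iid_def)
  have Y[measurable]: "Y i \<in> measurable M N'" for i
    using iv by (auto simp: indep_vars_def)
  let ?I = "{..<n}"
  let ?X = "\<lambda>\<omega>. \<lambda>i\<in>?I. X i \<omega>" and ?Y = "\<lambda>\<omega>. \<lambda>i\<in>?I. Y i \<omega>"
  let ?N = "\<Pi>\<^sub>M i\<in>?I. N" and ?N' = "\<Pi>\<^sub>M i\<in>?I. N'"
  have law: "distr M ?N' ?Y = (\<Pi>\<^sub>M i\<in>?I. G)"
  proof -
    have "indep_vars (\<lambda>_. N') Y ?I"
      using iv by (rule indep_vars_subset) auto
    then show ?thesis
      using n errors(2) by (subst (asm) indep_vars_iff_distr_eq_PiM') auto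
  qed
  have XM[measurable]: "?X \<in> measurable M ?N" and YM[measurable]: "?Y \<in> measurable M ?N'" by measurable
  interpret PX: prob_space "distr M ?N ?X" by (rule prob_space_distr) measurable
  interpret PY: prob_space "distr M ?N' ?Y" by (rule prob_space_distr) measurable
  have "distr M ?N ?X \<Otimes>\<^sub>M distr M ?N' ?Y = distr M (?N \<Otimes>\<^sub>M ?N') (\<lambda>\<omega>. (?X \<omega>, ?Y \<omega>))"
  proof (rule pair_measure_eqI)
    fix A B assume "A \<in> sets (distr M ?N ?X)" "B \<in> sets (distr M ?N' ?Y)"
    then have A[measurable]: "A \<in> sets ?N" and B[measurable]: "B \<in> sets ?N'" by auto
    have XS: "(\<lambda>\<omega> i. X i \<omega>) \<in> space M \<rightarrow> space (\<Pi>\<^sub>M i\<in>UNIV. N)"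
      using X[THEN measurable_space] by (auto simp: space_PiM)
    have YS: "(\<lambda>\<omega> i. Y i \<omega>) \<in> space M \<rightarrow> space (\<Pi>\<^sub>M i\<in>UNIV. N')"
      using Y[THEN measurable_space] by (auto simp: space_PiM)
    have "?X -` A \<inter> space M = (\<lambda>\<omega> i. X i \<omega>) -` ((\<lambda>x. \<lambda>i\<in>?I. x i) -` A \<inter> space (\<Pi>\<^sub>M i\<in>UNIV. N)) \<inter> space M"
      using XS by auto
    also have "\<dots> \<in> sets (vimage_algebra (space M) (\<lambda>\<omega> i. X i \<omega>) (\<Pi>\<^sub>M i\<in>UNIV. N))"
      by (rule in_vimage_algebra, rule measurable_sets[OF _ A]) measurable
    finally have 1: "?X -` A \<inter> space M \<in> \<dots>" .
    have "?Y -` B \<inter> space M = (\<lambda>\<omega> i. Y i \<omega>) -` ((\<lambda>x. \<lambda>i\<in>?I. x i) -` B \<inter> space (\<Pi>\<^sub>M i\<in>UNIV. N')) \<inter> space M"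
      using YS by auto
    also have "\<dots> \<in> sets (vimage_algebra (space M) (\<lambda>\<omega> i. Y i \<omega>) (\<Pi>\<^sub>M i\<in>UNIV. N'))"
      by (rule in_vimage_algebra, rule measurable_sets[OF _ B]) measurable
    finally have 2: "?Y -` B \<inter> space M \<in> \<dots>" .
    have "prob ((?X -` A \<inter> space M) \<inter> (?Y -` B \<inter> space M)) = prob (?X -` A \<inter> space M) * prob (?Y -` B \<inter> space M)"
      using indep 1 2 unfolding indep_sequences_def by (rule indep_setD)
    moreover have "(\<lambda>\<omega>. (?X \<omega>, ?Y \<omega>)) -` (A \<times> B) \<inter> space M = (?X -` A \<inter> space M) \<inter> (?Y -` B \<inter> space M)"
      by auto
    ultimately show "emeasure (distr M ?N ?X) A * emeasure (distr M ?N' ?Y) B =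
      emeasure (distr M (?N \<Otimes>\<^sub>M ?N') (\<lambda>\<omega>. (?X \<omega>, ?Y \<omega>))) (A \<times> B)"
      by (simp add: emeasure_distr emeasure_eq_measure ennreal_mult')
  qed (auto intro: PX.sigma_finite_measure_axioms PY.sigma_finite_measure_axioms)
  then show ?thesis by (simp add: law)
qed

text \<open>By independence both risks are iterated integrals whose inner integral runs over the
  errors with the design fixed, where the two-point bound applies with shifts
  \<open>T (x i)\<close>. Its left side is at least an affine function of the conditional Kullback
  sum, and a mean of at most 1/2 for that sum costs one further factor 2.\<close>

lemma regression_two_point:
  fixes \<epsilon> :: "nat \<Rightarrow> 'a \<Rightarrow> real"
  assumes M: "prob_space M" and X[measurable]: "\<And>i. X i \<in> measurable M N"
    and errors: "iid M borel \<epsilon>" "\<And>i. distr M borel (\<epsilon> i) = G"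
    and indep: "indep_sequences M N X borel \<epsilon>" and n: "0 < n"
    and I0: "0 < I\<^sub>0"
    and B1: "\<And>v. \<bar>v\<bar> \<le> v\<^sub>0 \<Longrightarrow> kullback G (distr G borel (\<lambda>u. u - v)) \<le> ereal (I\<^sub>0 * v\<^sup>2)"
    and T[measurable]: "T \<in> borel_measurable N" and T_le: "\<And>z. z \<in> space N \<Longrightarrow> \<bar>T z\<bar> \<le> v\<^sub>0"
    and small: "(\<integral>\<^sup>+\<omega>. (\<Sum>i<n. ennreal (I\<^sub>0 * (T (X i \<omega>))\<^sup>2)) \<partial>M) \<le> ennreal (1 / 2)"
    and est[measurable]: "est \<in> borel_measurable (\<Pi>\<^sub>M i\<in>{..<n}. N \<Otimes>\<^sub>M borel)"
  shows "ennreal ((a1 - a0)\<^sup>2 / 4) \<le>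
    (\<integral>\<^sup>+\<omega>. ennreal ((est (\<lambda>i\<in>{..<n}. (X i \<omega>, \<epsilon> i \<omega>)) - a0)\<^sup>2) \<partial>M) +
    (\<integral>\<^sup>+\<omega>. ennreal ((est (\<lambda>i\<in>{..<n}. (X i \<omega>, T (X i \<omega>) + \<epsilon> i \<omega>)) - a1)\<^sup>2) \<partial>M)"
    (is "_ \<le> ?M0 + ?M1")
proof -
  interpret prob_space M by fact
  let ?I = "{..<n}"
  let ?N = "\<Pi>\<^sub>M i\<in>?I. N" and ?B = "\<Pi>\<^sub>M i\<in>?I. borel :: real measure"
  let ?X = "\<lambda>\<omega>. \<lambda>i\<in>?I. X i \<omega>" and ?Y = "\<lambda>\<omega>. \<lambda>i\<in>?I. \<epsilon> i \<omega>"
  define PX where "PX = distr M ?N ?X"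
  have [measurable_cong]: "sets PX = sets ?N" by (simp add: PX_def)
  have Y[measurable]: "\<epsilon> i \<in> measurable M borel" for i
    using errors(1) by (auto simp: iid_def indep_vars_def)
  have G: "prob_space G" "sets G = sets borel"
    using errors(2)[of 0] prob_space_distr[OF Y] by auto
  interpret G: prob_space G by fact
  note [measurable_cong] = G(2)
  interpret PG: product_prob_space "\<lambda>_::nat. G" ?I by standard
  have joint: "(\<integral>\<^sup>+\<omega>. F (?X \<omega>, ?Y \<omega>) \<partial>M) = (\<integral>\<^sup>+x. \<integral>\<^sup>+e. F (x, e) \<partial>(\<Pi>\<^sub>M i\<in>?I. G) \<partial>PX)"
    if [measurable]: "F \<in> borel_measurable (?N \<Otimes>\<^sub>M ?B)" for F
  proof -
    have F': "F \<in> borel_measurable (PX \<Otimes>\<^sub>M (\<Pi>\<^sub>M i\<in>?I. G))" by measurable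
    have "(\<integral>\<^sup>+\<omega>. F (?X \<omega>, ?Y \<omega>) \<partial>M) = (\<integral>\<^sup>+z. F z \<partial>distr M (?N \<Otimes>\<^sub>M ?B) (\<lambda>\<omega>. (?X \<omega>, ?Y \<omega>)))"
      by (subst nn_integral_distr) measurable
    also have "\<dots> = (\<integral>\<^sup>+z. F z \<partial>(PX \<Otimes>\<^sub>M (\<Pi>\<^sub>M i\<in>?I. G)))"
      unfolding PX_def by (subst distr_independent_sequences[OF M X errors indep n]) simp
    also have "\<dots> = (\<integral>\<^sup>+x. \<integral>\<^sup>+e. F (x, e) \<partial>(\<Pi>\<^sub>M i\<in>?I. G) \<partial>PX)"
      by (rule PG.P.nn_integral_fst[OF F', symmetric])
    finally show ?thesis .
  qed
  define F0 where "F0 = (\<lambda>(x, e). ennreal ((est (\<lambda>i\<in>?I. (x i, e i)) - a0)\<^sup>2))"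
  define F1 where "F1 = (\<lambda>(x, e). ennreal ((est (\<lambda>i\<in>?I. (x i, T (x i) + e i)) - a1)\<^sup>2))"
  have F0[measurable]: "F0 \<in> borel_measurable (?N \<Otimes>\<^sub>M ?B)" unfolding F0_def by measurable
  have F1[measurable]: "F1 \<in> borel_measurable (?N \<Otimes>\<^sub>M ?B)" unfolding F1_def by measurable
  have F0'[measurable]: "F0 \<in> borel_measurable (PX \<Otimes>\<^sub>M (\<Pi>\<^sub>M i\<in>?I. G))" by measurable
  have F1'[measurable]: "F1 \<in> borel_measurable (PX \<Otimes>\<^sub>M (\<Pi>\<^sub>M i\<in>?I. G))" by measurable
  have M0: "?M0 = (\<integral>\<^sup>+x. \<integral>\<^sup>+e. F0 (x, e) \<partial>(\<Pi>\<^sub>M i\<in>?I. G) \<partial>PX)"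
    by (subst joint[symmetric], measurable)
       (auto simp: F0_def intro!: nn_integral_cong arg_cong[where f="\<lambda>x. ennreal ((est x - a0)\<^sup>2)"] restrict_ext)
  have M1: "?M1 = (\<integral>\<^sup>+x. \<integral>\<^sup>+e. F1 (x, e) \<partial>(\<Pi>\<^sub>M i\<in>?I. G) \<partial>PX)"
    by (subst joint[symmetric], measurable)
       (auto simp: F1_def intro!: nn_integral_cong arg_cong[where f="\<lambda>x. ennreal ((est x - a1)\<^sup>2)"] restrict_ext)
  define S where "S x = (\<Sum>i<n. I\<^sub>0 * (T (x i))\<^sup>2)" for x
  have S[measurable]: "S \<in> borel_measurable PX" unfolding S_def by measurable
  have S0: "0 \<le> S x" for x using I0 unfolding S_def by (intro sum_nonneg) auto
  have cond: "ennreal ((a1 - a0)\<^sup>2 / 2 * (1 - S x)) \<le>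
      (\<integral>\<^sup>+e. F0 (x, e) \<partial>(\<Pi>\<^sub>M i\<in>?I. G)) + (\<integral>\<^sup>+e. F1 (x, e) \<partial>(\<Pi>\<^sub>M i\<in>?I. G))"
    if x: "x \<in> space PX" for x
  proof -
    have xN: "x i \<in> space N" if "i < n" for i
      using x that by (auto simp: PX_def space_PiM PiE_iff)
    \<comment> \<open>The law of the error plus \<open>T (x i)\<close> is the translate of (B1) with
      \<open>v = - T (x i)\<close>.\<close>
    have kl: "kullback G (distr G borel (\<lambda>u. u + T (x i))) \<le> ereal (I\<^sub>0 * (T (x i))\<^sup>2)" if "i \<in> ?I" for i
      using B1[of "- T (x i)"] T_le[OF xN] that by auto
    have meas: "(\<lambda>e. est (\<lambda>i\<in>?I. (x i, e i))) \<in> borel_measurable ?B"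
      by (rule measurable_compose[OF _ est], intro measurable_restrict measurable_Pair measurable_const measurable_component_singleton)
        (auto intro: xN)
    show ?thesis
      using two_point_bound[of G ?I "\<lambda>i. T (x i)" "\<lambda>i. I\<^sub>0 * (T (x i))\<^sup>2", OF G _ kl _ meas, of a1 a0] I0
      by (simp add: F0_def F1_def S_def add.commute cong: restrict_cong)
  qed
  have PX1: "emeasure PX (space PX) = 1"
    unfolding PX_def by (intro prob_space.emeasure_space_1 prob_space_distr) measurable
  have small': "(\<integral>\<^sup>+x. ennreal (S x) \<partial>PX) \<le> ennreal (1 / 2)"
  proof -
    have "(\<integral>\<^sup>+x. ennreal (S x) \<partial>PX) = (\<integral>\<^sup>+\<omega>. ennreal (S (?X \<omega>)) \<partial>M)"
      unfolding PX_def using S by (subst nn_integral_distr) (auto simp: PX_def)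
    also have "\<dots> = (\<integral>\<^sup>+\<omega>. (\<Sum>i<n. ennreal (I\<^sub>0 * (T (X i \<omega>))\<^sup>2)) \<partial>M)"
      using I0 by (intro nn_integral_cong) (simp add: S_def sum_ennreal)
    finally show ?thesis using small by simp
  qed
  define d where "d = (a1 - a0)\<^sup>2 / 2"
  have d: "0 \<le> d" by (simp add: d_def)
  have "ennreal d = (\<integral>\<^sup>+x. ennreal d \<partial>PX)"
    using PX1 by simp
  \<comment> \<open>For a design with \<open>S x > 1\<close> the first summand is truncated to 0,
    but the second alone is already at least \<open>d\<close>; hence the inequality holds for every
    design.\<close>
  also have "\<dots> \<le> (\<integral>\<^sup>+x. ennreal (d * (1 - S x)) + ennreal d * ennreal (S x) \<partial>PX)"
  proof (rule nn_integral_mono)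
    fix x
    have "ennreal d \<le> ennreal (d * (1 - S x) + d * S x)"
      by (simp add: algebra_simps)
    also have "\<dots> \<le> ennreal (d * (1 - S x)) + ennreal (d * S x)"
    proof (cases "0 \<le> d * (1 - S x)")
      case True
      then show ?thesis using d S0[of x] by (subst ennreal_plus) auto
    next
      case False
      then show ?thesis by (simp add: ennreal_neg ennreal_leI)
    qed
    finally show "ennreal d \<le> ennreal (d * (1 - S x)) + ennreal d * ennreal (S x)"
      using d by (simp only: ennreal_mult')
  qed
  also have "\<dots> = (\<integral>\<^sup>+x. ennreal (d * (1 - S x)) \<partial>PX) + ennreal d * (\<integral>\<^sup>+x. ennreal (S x) \<partial>PX)"
    by (subst nn_integral_add, measurable) (subst nn_integral_cmult, auto)
  also have "\<dots> \<le> (\<integral>\<^sup>+x. (\<integral>\<^sup>+e. F0 (x, e) \<partial>(\<Pi>\<^sub>M i\<in>?I. G)) + (\<integral>\<^sup>+e. F1 (x, e) \<partial>(\<Pi>\<^sub>M i\<in>?I. G)) \<partial>PX) +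
      ennreal d * ennreal (1 / 2)"
    by (intro add_mono mult_left_mono nn_integral_mono cond[folded d_def] small') auto
  also have "(\<integral>\<^sup>+x. (\<integral>\<^sup>+e. F0 (x, e) \<partial>(\<Pi>\<^sub>M i\<in>?I. G)) + (\<integral>\<^sup>+e. F1 (x, e) \<partial>(\<Pi>\<^sub>M i\<in>?I. G)) \<partial>PX) = ?M0 + ?M1"
    unfolding M0 M1 by (intro nn_integral_add PG.P.borel_measurable_nn_integral_fst F0' F1')
  also have "ennreal d * ennreal (1 / 2) = ennreal (d / 2)"
    using d by (subst ennreal_mult'[symmetric]) auto
  finally have "ennreal d - ennreal (d / 2) \<le> ?M0 + ?M1"
    by (simp only: ennreal_minus_le_iff add.commute) simp
  moreover have "ennreal d - ennreal (d / 2) = ennreal ((a1 - a0)\<^sup>2 / 4)"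
    using d by (subst ennreal_minus) (auto simp: d_def)
  ultimately show ?thesis
    by simp
qed

section \<open>B-splines and Sobolev bumps\<close>

definition fourier1 :: "(real \<Rightarrow> real) \<Rightarrow> real \<Rightarrow> complex" where
  "fourier1 g \<xi> = (\<integral>t. complex_of_real (g t) * exp (- \<i> * complex_of_real (\<xi> * t)) \<partial>lborel)"

text \<open>Up to scaling this is the centred cardinal B-spline: \<open>bspline k\<close> is the
  convolution of \<open>k + 1\<close> copies of the indicator, whence the exponents
  \<open>Suc k\<close> and the support bound \<open>k + 1\<close> below.\<close>

primrec bspline :: "nat \<Rightarrow> real \<Rightarrow> real" where
  "bspline 0 = indicator {-1..1}"
| "bspline (Suc k) = (\<lambda>t. \<integral>s. indicator {-1..1} s * bspline k (t - s) \<partial>lborel)"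

lemma borel_measurable_bspline [measurable]: "bspline k \<in> borel_measurable borel"
  by (induction k) simp_all

lemma bspline_bounds: "0 \<le> bspline k t \<and> bspline k t \<le> 2 ^ k"
proof (induction k arbitrary: t)
  case (Suc k)
  have abs: "\<bar>bspline k t\<bar> \<le> 2 ^ k" for t
    using Suc[of t] by (simp add: abs_of_nonneg)
  have int: "integrable lborel (\<lambda>s. indicator {-1..1} s * bspline k (t - s))"
    using Suc by (intro integrableI_bounded_set[where B="2^k" and A="{-1..1}"])
      (auto simp: abs intro!: AE_I2)
  have "(\<integral>s. indicator {-1..1::real} s * bspline k (t - s) \<partial>lborel) \<le> (\<integral>s. indicator {-1..1::real} s * 2 ^ k \<partial>lborel)"
  proof (rule integral_mono[OF int])
    show "integrable lborel (\<lambda>s. indicator {-1..1::real} s * 2 ^ k :: real)"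
      by (intro integrable_mult_left integrable_real_indicator) auto
    show "indicator {-1..1} s * bspline k (t - s) \<le> indicator {-1..1} s * 2 ^ k" for s
      using Suc[of "t - s"] by (intro mult_left_mono) auto
  qed
  moreover have "0 \<le> (\<integral>s. indicator {-1..1} s * bspline k (t - s) \<partial>lborel)"
    using Suc by (intro Bochner_Integration.integral_nonneg) auto
  ultimately show ?case by simp
qed (auto simp: indicator_def)

lemma abs_bspline_le: "\<bar>bspline k t\<bar> \<le> 2 ^ k"
  using bspline_bounds[of k t] by (simp add: abs_of_nonneg)

lemma bspline_support: "\<bar>t\<bar> > real k + 1 \<Longrightarrow> bspline k t = 0"
proof (induction k arbitrary: t)
  case (Suc k)
  have "indicator {-1..1} s * bspline k (t - s) = 0" for s
    using Suc.prems by (cases "\<bar>s\<bar> \<le> 1") (auto intro!: Suc.IH simp: indicator_def)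
  then have "(\<lambda>s. indicator {-1..1} s * bspline k (t - s)) = (\<lambda>_. 0)"
    by (intro ext)
  then show ?case by (simp only: bspline.simps Bochner_Integration.integral_zero)
qed (auto simp: indicator_def)

lemma integrable_bspline: "integrable lborel (bspline k)"
proof (rule integrableI_bounded_set[where A="{- real k - 1..real k + 1}" and B="2 ^ k"])
  show "AE t in lborel. t \<notin> {- real k - 1..real k + 1} \<longrightarrow> bspline k t = 0"
    using bspline_support[of k] by (auto intro!: AE_I2 simp: abs_if split: if_splits)
qed (auto simp: abs_bspline_le)

text \<open>This is the convolution theorem. The double integrand is bounded and vanishes off a
  rectangle, so Fubini applies, and substituting \<open>s + t\<close> in the inner integral splits
  off the phase at \<open>s\<close>.\<close>

lemma fourier1_bspline_Suc:
  "fourier1 (bspline (Suc k)) \<xi> = fourier1 (bspline 0) \<xi> * fourier1 (bspline k) \<xi>"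
proof -
  let ?e = "\<lambda>t. exp (- \<i> * complex_of_real (\<xi> * t))"
  define F where "F s t = complex_of_real (indicator {-1..1} s * bspline k (t - s)) * ?e t" for s t
  have F[measurable]: "case_prod F \<in> borel_measurable (lborel \<Otimes>\<^sub>M lborel)"
    unfolding F_def by measurable
  \<comment> \<open>\<open>bspline k\<close> vanishes beyond \<open>k + 1\<close>, and the
    translation by \<open>s\<close> adds at most 1.\<close>
  let ?R = "real k + 2"
  have int: "integrable (lborel \<Otimes>\<^sub>M lborel) (case_prod F)"
  proof (rule integrableI_bounded_set[where A="{-1..1} \<times> {-?R..?R}" and B="2 ^ k"])
    show "emeasure (lborel \<Otimes>\<^sub>M lborel) ({-1..1::real} \<times> {-?R..?R}) < \<infinity>"
      by (subst lborel.emeasure_pair_measure_Times) (auto simp: ennreal_mult_less_top)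
    show "AE x in lborel \<Otimes>\<^sub>M lborel. x \<in> {-1..1} \<times> {-?R..?R} \<longrightarrow> norm (case_prod F x) \<le> 2 ^ k"
      by (auto simp: F_def norm_mult indicator_def abs_bspline_le intro!: AE_I2)
    show "AE x in lborel \<Otimes>\<^sub>M lborel. x \<notin> {-1..1} \<times> {-?R..?R} \<longrightarrow> case_prod F x = 0"
      by (auto simp: F_def indicator_def intro!: AE_I2 bspline_support)
  qed measurable
  have "fourier1 (bspline (Suc k)) \<xi> = (\<integral>t. (\<integral>s. F s t \<partial>lborel) \<partial>lborel)"
    unfolding fourier1_def F_def by (simp del: of_real_mult)
  also have "\<dots> = (\<integral>s. (\<integral>t. F s t \<partial>lborel) \<partial>lborel)"
    using int by (rule lborel_pair.Fubini_integral)
  also have "\<dots> = (\<integral>s. complex_of_real (indicator {-1..1} s) * ?e s * fourier1 (bspline k) \<xi> \<partial>lborel)"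
  proof (rule Bochner_Integration.integral_cong[OF refl])
    fix s
    have "(\<integral>t. F s t \<partial>lborel) = (\<integral>t. F s (s + t) \<partial>lborel)"
      using lborel_integral_real_affine[of 1 "F s" s] by simp
    also have "\<dots> = (\<integral>t. complex_of_real (indicator {-1..1} s) * ?e s * (complex_of_real (bspline k t) * ?e t) \<partial>lborel)"
      by (intro Bochner_Integration.integral_cong) (auto simp: F_def distrib_left exp_add[symmetric] algebra_simps)
    also have "\<dots> = complex_of_real (indicator {-1..1} s) * ?e s * fourier1 (bspline k) \<xi>"
      by (simp add: fourier1_def)
    finally show "(\<integral>t. F s t \<partial>lborel) = \<dots>" .
  qed
  also have "\<dots> = fourier1 (bspline 0) \<xi> * fourier1 (bspline k) \<xi>"
    by (simp add: fourier1_def)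
  finally show ?thesis .
qed

lemma fourier1_bspline: "fourier1 (bspline k) \<xi> = fourier1 (bspline 0) \<xi> ^ Suc k"
  by (induction k) (simp_all add: fourier1_bspline_Suc del: bspline.simps)

text \<open>The transform is at most 2 by the length of the interval, and at most
  \<open>2 / \<bar>\<xi>\<bar>\<close> by integrating the exponential; the two squared bounds add up
  to 4 + 4. Together they cover low and high frequencies in one estimate.\<close>

lemma norm_fourier1_bspline_0: "(cmod (fourier1 (bspline 0) \<xi>))\<^sup>2 * (1 + \<xi>\<^sup>2) \<le> 8"
proof -
  let ?F = "fourier1 (bspline 0) \<xi>"
  have eq: "?F = (\<integral>t. indicator {-1..1} t *\<^sub>R exp (- \<i> * complex_of_real (\<xi> * t)) \<partial>lborel)"
    unfolding fourier1_def by (intro Bochner_Integration.integral_cong) (auto simp: scaleR_conv_of_real)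
  have "cmod ?F \<le> (\<integral>t. cmod (indicator {-1..1} t *\<^sub>R exp (- \<i> * complex_of_real (\<xi> * t))) \<partial>lborel)"
    unfolding eq by (rule integral_norm_bound)
  also have "\<dots> = (\<integral>t. indicator {-1..1::real} t \<partial>lborel)"
    by (rule Bochner_Integration.integral_cong) (auto simp: norm_exp_eq_Re)
  finally have 1: "cmod ?F \<le> 2" by simp
  have 2: "cmod ?F * \<bar>\<xi>\<bar> \<le> 2"
  proof (cases "\<xi> = 0")
    case False
    let ?P = "\<lambda>t. \<i> / complex_of_real \<xi> * exp (- \<i> * complex_of_real (\<xi> * t))"
    have "?F = ?P 1 - ?P (- 1)"
      unfolding eq
    proof (rule integral_FTC_Icc)
      fix x :: real assume "-1 \<le> x" "x \<le> 1"
      show "(?P has_vector_derivative exp (- \<i> * complex_of_real (\<xi> * x))) (at x within {-1..1})"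
        using False by (auto intro!: derivative_eq_intros has_vector_derivative_real_field simp: field_simps)
    qed (auto intro!: continuous_intros)
    also have "cmod \<dots> \<le> cmod (?P 1) + cmod (?P (- 1))"
      by (rule norm_triangle_ineq4)
    also have "\<dots> = 2 / \<bar>\<xi>\<bar>"
      by (simp add: norm_mult norm_divide)
    finally show ?thesis using False by (simp add: field_simps)
  qed simp
  have "(cmod ?F)\<^sup>2 \<le> 2\<^sup>2" "(cmod ?F * \<bar>\<xi>\<bar>)\<^sup>2 \<le> 2\<^sup>2"
    using 1 2 by (intro power_mono; simp)+
  then show ?thesis
    by (simp add: power_mult_distrib algebra_simps)
qed

lemma norm_fourier1_bspline: "(cmod (fourier1 (bspline k) \<xi>))\<^sup>2 \<le> (8 / (1 + \<xi>\<^sup>2)) ^ Suc k"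
proof -
  have "(cmod (fourier1 (bspline k) \<xi>))\<^sup>2 = ((cmod (fourier1 (bspline 0) \<xi>))\<^sup>2) ^ Suc k"
    by (subst fourier1_bspline) (simp only: norm_power flip: power_mult, simp add: mult.commute)
  also have "\<dots> \<le> (8 / (1 + \<xi>\<^sup>2)) ^ Suc k"
    using norm_fourier1_bspline_0[of \<xi>]
    by (intro power_mono) (auto simp: pos_le_divide_eq add_pos_nonneg)
  finally show ?thesis .
qed

text \<open>At frequency zero the transform is a power of 2, so the spline cannot vanish
  identically. This spares locating a point where it is positive.\<close>

lemma bspline_pos: obtains t where "bspline k t > 0"
proof -
  have "fourier1 (bspline 0) 0 = 2"
    by (simp add: fourier1_def)
  then have "fourier1 (bspline k) 0 \<noteq> 0"
    by (subst fourier1_bspline) simp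
  then have "\<exists>t. bspline k t \<noteq> 0"
    unfolding fourier1_def by (metis (mono_tags, lifting) mult_zero_left of_real_0 Bochner_Integration.integral_zero Bochner_Integration.integral_cong)
  then show ?thesis
    using that bspline_bounds[of k] by (metis order_le_less)
qed

text \<open>A convolution with the indicator integrates over a sliding window. Moving the window
  changes the integral only on two end intervals of length \<open>t' - t\<close>, where the
  integrand is at most \<open>2 ^ k\<close>.\<close>

lemma bspline_lipschitz:
  assumes "t \<le> t'"
  shows "\<bar>bspline (Suc k) t' - bspline (Suc k) t\<bar> \<le> 2 ^ Suc k * (t' - t)"
proof -
  have eq: "bspline (Suc k) x = (\<integral>u. indicator {x - 1..x + 1} u * bspline k u \<partial>lborel)" for x
    using lborel_integral_real_affine[of "-1" "\<lambda>u. indicator {x - 1..x + 1} u * bspline k u" x]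
    by (auto simp: indicator_def intro!: Bochner_Integration.integral_cong)
  have int: "integrable lborel (\<lambda>u. indicator {x - 1..x + 1} u * bspline k u)" for x
    by (intro integrableI_bounded_set[where B="2^k" and A="{x - 1..x + 1}"])
      (auto simp: abs_bspline_le intro!: AE_I2)
  have "\<bar>bspline (Suc k) t' - bspline (Suc k) t\<bar> =
      \<bar>\<integral>u. indicator {t' - 1..t' + 1} u * bspline k u - indicator {t - 1..t + 1} u * bspline k u \<partial>lborel\<bar>"
    unfolding eq by (subst Bochner_Integration.integral_diff[OF int int]) simp
  also have "\<dots> \<le> (\<integral>u. \<bar>indicator {t' - 1..t' + 1} u * bspline k u - indicator {t - 1..t + 1} u * bspline k u\<bar> \<partial>lborel)"
    by (rule integral_abs_bound)
  also have "\<dots> \<le> (\<integral>u. 2 ^ k * indicator {t - 1..t' - 1} u + 2 ^ k * indicator {t + 1..t' + 1} u \<partial>lborel)"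
  proof (rule integral_mono)
    fix u
    show "\<bar>indicator {t' - 1..t' + 1} u * bspline k u - indicator {t - 1..t + 1} u * bspline k u\<bar>
      \<le> 2 ^ k * indicator {t - 1..t' - 1} u + 2 ^ k * indicator {t + 1..t' + 1} u"
      using bspline_bounds[of k u] assms by (auto simp: indicator_def)
  qed (auto intro!: integrable_abs Bochner_Integration.integrable_diff int Bochner_Integration.integrable_add
      integrable_mult_right integrable_real_indicator simp: emeasure_lborel_Icc_eq)
  also have "\<dots> = 2 ^ Suc k * (t' - t)"
    using assms by (subst Bochner_Integration.integral_add)
      (auto intro!: integrable_mult_right integrable_real_indicator simp: emeasure_lborel_Icc_eq)
  finally show ?thesis .
qed

lemma continuous_bspline:
  assumes "0 < k"
  shows "continuous_on UNIV (bspline k)"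
proof -
  from assms obtain m where k: "k = Suc m" by (cases k) auto
  have "(2 ^ Suc m)-lipschitz_on UNIV (bspline (Suc m))"
  proof (rule lipschitz_onI)
    fix x y
    show "dist (bspline (Suc m) x) (bspline (Suc m) y) \<le> 2 ^ Suc m * dist x y"
      using bspline_lipschitz[of x y m] bspline_lipschitz[of y x m] by (cases "x \<le> y") (simp_all add: dist_real_def abs_minus_commute del: bspline.simps)
  qed simp
  then show ?thesis unfolding k by (rule lipschitz_on_continuous_on)
qed

section \<open>Integrals and transforms of functions that factor over the coordinates\<close>

lemma Basis_cart: "(Basis :: (real^'n) set) = (\<lambda>i. axis i 1) ` UNIV"
  by (auto simp: Basis_vec_def)

lemma inj_axis_1: "inj (\<lambda>i. axis i (1::real) :: real^'n)"
  by (auto simp: inj_on_def axis_eq_axis)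

lemma prod_Basis_cart:
  "(\<Prod>b\<in>(Basis :: (real^'n) set). h b) = (\<Prod>i\<in>UNIV. h (axis i 1))"
  unfolding Basis_cart by (simp add: prod.reindex inj_axis_1)

lemma integral_prod_cart:
  fixes F :: "'n::finite \<Rightarrow> real \<Rightarrow> complex"
  assumes int: "\<And>i. integrable lborel (F i)"
  shows "(\<integral>x. (\<Prod>i\<in>UNIV. F i (x $ i)) \<partial>(lborel :: (real^'n) measure)) = (\<Prod>i\<in>UNIV. \<integral>t. F i t \<partial>lborel)"
proof -
  interpret product_sigma_finite "\<lambda>_::real^'n. lborel :: real measure" by standard
  have [measurable]: "\<And>i. F i \<in> borel_measurable borel" using int by auto
  define j where "j = inv (\<lambda>i. axis i (1::real) :: real^'n)"
  have j: "j (axis i 1) = i" for i unfolding j_def by (rule inv_f_f[OF inj_axis_1])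
  have nth: "(\<Sum>b\<in>Basis. f b *\<^sub>R b) $ i = f (axis i 1)" for f :: "real^'n \<Rightarrow> real" and i
    by (subst cart_eq_inner_axis, subst inner_sum_left_Basis) (auto simp: Basis_cart)
  have "(\<integral>x. (\<Prod>i\<in>UNIV. F i (x $ i)) \<partial>(lborel :: (real^'n) measure)) =
     (\<integral>f. (\<Prod>i\<in>UNIV. F i ((\<Sum>b\<in>(Basis::(real^'n) set). f b *\<^sub>R b) $ i)) \<partial>(\<Pi>\<^sub>M b\<in>(Basis::(real^'n) set). lborel))"
    by (subst lborel_eq, subst integral_distr) measurable
  also have "\<dots> = (\<integral>f. (\<Prod>b\<in>Basis. F (j b) (f b)) \<partial>(\<Pi>\<^sub>M b\<in>(Basis::(real^'n) set). lborel))"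
    by (simp only: nth prod_Basis_cart j)
  also have "\<dots> = (\<Prod>b\<in>(Basis::(real^'n) set). \<integral>t. F (j b) t \<partial>lborel)"
    by (intro product_integral_prod int) auto
  also have "\<dots> = (\<Prod>i\<in>UNIV. \<integral>t. F i t \<partial>lborel)"
    by (simp add: prod_Basis_cart j)
  finally show ?thesis .
qed

lemma nn_integral_prod_cart:
  fixes F :: "'n::finite \<Rightarrow> real \<Rightarrow> ennreal"
  assumes [measurable]: "\<And>i. F i \<in> borel_measurable borel"
  shows "(\<integral>\<^sup>+x. (\<Prod>i\<in>UNIV. F i (x $ i)) \<partial>(lborel :: (real^'n) measure)) = (\<Prod>i\<in>UNIV. \<integral>\<^sup>+t. F i t \<partial>lborel)"
proof -
  define j where "j = inv (\<lambda>i. axis i (1::real) :: real^'n)"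
  have j: "j (axis i 1) = i" for i unfolding j_def by (rule inv_f_f[OF inj_axis_1])
  have "(\<integral>\<^sup>+x. (\<Prod>b\<in>Basis. F (j b) (x \<bullet> b)) \<partial>(lborel :: (real^'n) measure)) = (\<Prod>b\<in>(Basis::(real^'n) set). \<integral>\<^sup>+t. F (j b) t \<partial>lborel)"
    by (rule nn_integral_lborel_prod) auto
  then show ?thesis
    by (simp add: prod_Basis_cart j cart_eq_inner_axis)
qed

text \<open>The translation contributes only a phase. Passing to the modulus removes it, which makes
  the Sobolev bound independent of the location of the bump.\<close>

lemma fourier1_affine:
  assumes h: "0 < h"
  shows "cmod (fourier1 (\<lambda>t. g ((t - c) / h)) \<xi>) = h * cmod (fourier1 g (h * \<xi>))"
proof -
  have "fourier1 (\<lambda>t. g ((t - c) / h)) \<xi> =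
      h *\<^sub>R (\<integral>u. exp (- \<i> * complex_of_real (\<xi> * c)) *
        (complex_of_real (g u) * exp (- \<i> * complex_of_real (h * \<xi> * u))) \<partial>lborel)"
    unfolding fourier1_def using h
    by (subst lborel_integral_real_affine[where c=h and t=c])
      (auto intro!: arg_cong[where f="\<lambda>x. _ * x"] Bochner_Integration.integral_cong
        simp: scaleR_conv_of_real exp_add[symmetric] algebra_simps)
  also have "\<dots> = h *\<^sub>R (exp (- \<i> * complex_of_real (\<xi> * c)) * fourier1 g (h * \<xi>))"
    by (simp add: fourier1_def)
  finally show ?thesis
    using h by (simp add: norm_mult norm_exp_eq_Re)
qed

lemma fourier_prod:
  assumes "\<And>i. integrable lborel (g i)"
  shows "fourier (\<lambda>x. a * (\<Prod>i\<in>UNIV. g i (x $ i))) \<xi> = complex_of_real a * (\<Prod>i\<in>UNIV. fourier1 (g i) (\<xi> $ i))"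
proof -
  have exp: "exp (- \<i> * complex_of_real (\<xi> \<bullet> x)) = (\<Prod>i\<in>UNIV. exp (- \<i> * complex_of_real (\<xi> $ i * x $ i)))" for x
    by (simp add: inner_vec_def sum_distrib_left exp_sum flip: sum_negf)
  have int: "integrable lborel (\<lambda>t. complex_of_real (g i t) * exp (- \<i> * complex_of_real (\<xi> $ i * t)))" for i
    by (rule Bochner_Integration.integrable_bound[OF assms[of i]])
      (use assms in \<open>auto simp: norm_mult norm_exp_eq_Re\<close>)
  have "fourier (\<lambda>x. a * (\<Prod>i\<in>UNIV. g i (x $ i))) \<xi> =
     (\<integral>x. complex_of_real a * (\<Prod>i\<in>UNIV. complex_of_real (g i (x $ i)) * exp (- \<i> * complex_of_real (\<xi> $ i * x $ i))) \<partial>lborel)"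
    unfolding fourier_def exp by (simp add: prod.distrib mult.assoc)
  also have "\<dots> = complex_of_real a * (\<Prod>i\<in>UNIV. fourier1 (g i) (\<xi> $ i))"
    by (simp only: integral_mult_right_zero integral_prod_cart[OF int] fourier1_def)
  finally show ?thesis .
qed

lemma nn_integral_cauchy: "0 < h \<Longrightarrow> (\<integral>\<^sup>+x. ennreal (1 / (1 + (h * x)\<^sup>2)) \<partial>lborel) = ennreal (pi / h)"
proof -
  assume h: "0 < h"
  have int: "integrable lborel (\<lambda>x::real. inverse (1 + x\<^sup>2))"
    using integrable_inverse_1_plus_square by (simp add: set_integrable_def)
  have "(\<integral>x. inverse (1 + x\<^sup>2) \<partial>(lborel :: real measure)) = pi"
    using LBINT_inverse_1_plus_square
    by (simp add: interval_lebesgue_integral_def set_lebesgue_integral_def)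
  then have pi: "(\<integral>\<^sup>+x. ennreal (inverse (1 + x\<^sup>2)) \<partial>(lborel :: real measure)) = ennreal pi"
    using int by (subst nn_integral_eq_integral) auto
  have "ennreal pi = ennreal h * (\<integral>\<^sup>+x. ennreal (1 / (1 + (h * x)\<^sup>2)) \<partial>lborel)"
    unfolding pi[symmetric] using h
    by (subst nn_integral_real_affine[where c=h and t=0]) (auto simp: inverse_eq_divide)
  then have "ennreal (1 / h) * ennreal pi = ennreal (1 / h) * ennreal h * (\<integral>\<^sup>+x. ennreal (1 / (1 + (h * x)\<^sup>2)) \<partial>lborel)"
    by (simp add: mult.assoc)
  then show ?thesis
    using h by (simp add: ennreal_mult'[symmetric])
qed



text \<open>The Sobolev weight does not factor over the coordinates, but it is dominated by a
  product in the rescaled frequencies \<open>h * \<xi>\<close>. The price \<open>h powr (-2)\<close>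
  becomes \<open>h powr (- 2 * \<beta>)\<close> in the norm.\<close>

lemma one_plus_sum_le_prod:
  fixes x :: "real^2"
  assumes "0 < h" "h \<le> 1"
  shows "1 + (norm x)\<^sup>2 \<le> h powr (-2) * (\<Prod>i\<in>UNIV. 1 + (h * x $ i)\<^sup>2)"
proof -
  have "h\<^sup>2 \<le> 1" using assms by (simp add: power_le_one)
  then have "h\<^sup>2 * (1 + (norm x)\<^sup>2) \<le> 1 + (h * x $ 1)\<^sup>2 + (h * x $ 2)\<^sup>2"
    by (simp add: norm_vec_def L2_set_def UNIV_2 power_mult_distrib algebra_simps)
  also have "\<dots> \<le> (\<Prod>i\<in>UNIV. 1 + (h * x $ i)\<^sup>2)"
    by (simp add: UNIV_2 algebra_simps)
  finally show ?thesis
    using assms by (simp add: powr_minus powr_numeral field_simps)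
qed

section \<open>Bumps in the plane and their Sobolev norms\<close>

text \<open>\<open>c\<close> is the centre of the square that contains the support and
  \<open>a\<close> an amplitude; the point where the value is prescribed, and the value there, are
  adjusted afterwards.\<close>

definition bump :: "nat \<Rightarrow> real \<Rightarrow> real \<Rightarrow> real^2 \<Rightarrow> real^2 \<Rightarrow> real" where
  "bump k a h c x = a * (\<Prod>i\<in>UNIV. bspline k ((x $ i - c $ i) / h))"

lemma integrable_bspline_affine: "0 < h \<Longrightarrow> integrable lborel (\<lambda>t. bspline k ((t - c) / h))"
  using lborel_integrable_real_affine[OF integrable_bspline, of "1 / h" k "- c / h"]
  by (simp add: diff_divide_distrib)

text \<open>Of the \<open>k + 1\<close> decay factors in each coordinate, \<open>k\<close> absorb
  the weight, as \<open>\<beta> \<le> real k\<close>, and the last one leaves a Cauchy density up to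
  constants. The squared transform contributes \<open>h ^ 4\<close>, the weight
  \<open>h powr (- 2 * \<beta>)\<close> and the two Cauchy integrals \<open>h powr (-2)\<close>,
  which gives the exponent \<open>2 - 2 * \<beta>\<close>.\<close>

lemma bump_sobolev_norm:
  assumes h: "0 < h" "h \<le> 1" and k: "\<beta> \<le> real k" and "0 \<le> \<beta>"
  shows "(\<integral>\<^sup>+\<xi>. ennreal ((1 + (norm \<xi>)\<^sup>2) powr \<beta> * (cmod (fourier (bump k a h c) \<xi>))\<^sup>2) \<partial>lborel)
    \<le> ennreal ((8 ^ Suc k * pi)\<^sup>2 * a\<^sup>2 * h powr (2 - 2 * \<beta>))"
proof -
  let ?m = "8 ^ Suc k :: real"
  have F: "cmod (fourier (bump k a h c) \<xi>) = \<bar>a\<bar> * (\<Prod>i\<in>UNIV. h * cmod (fourier1 (bspline k) (h * \<xi> $ i)))" for \<xi>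
    unfolding bump_def using h
    by (subst fourier_prod[OF integrable_bspline_affine]) (simp_all add: norm_mult fourier1_affine flip: prod_norm)
  have le: "(1 + (norm \<xi>)\<^sup>2) powr \<beta> * (cmod (fourier (bump k a h c) \<xi>))\<^sup>2 \<le>
     a\<^sup>2 * h powr (- 2 * \<beta>) * (\<Prod>i\<in>UNIV. h\<^sup>2 * ?m * (1 / (1 + (h * \<xi> $ i)\<^sup>2)))" for \<xi> :: "real^2"
  proof -
    let ?p = "\<lambda>i. 1 + (h * \<xi> $ i)\<^sup>2"
    have p: "1 \<le> ?p i" for i by simp
    have cancel: "p ^ k * (h\<^sup>2 * (8 / p) ^ Suc k) = h\<^sup>2 * ?m * (1 / p)" if "p > 0" for p
      using that by (simp add: power_divide field_simps)
    have factor: "?p i powr \<beta> * (h * cmod (fourier1 (bspline k) (h * \<xi> $ i)))\<^sup>2 \<le> h\<^sup>2 * ?m * (1 / ?p i)" for i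
    proof -
      have "?p i powr \<beta> \<le> ?p i powr real k"
        using p k by (rule powr_mono[rotated])
      also have "\<dots> = ?p i ^ k" using p[of i] by (intro powr_realpow) linarith
      finally have "?p i powr \<beta> * (h * cmod (fourier1 (bspline k) (h * \<xi> $ i)))\<^sup>2 \<le>
         ?p i ^ k * (h\<^sup>2 * (8 / ?p i) ^ Suc k)"
        unfolding power_mult_distrib
        by (intro mult_mono mult_left_mono norm_fourier1_bspline[of k "h * \<xi> $ i", unfolded power_mult_distrib]) auto
      also have "\<dots> = h\<^sup>2 * ?m * (1 / ?p i)"
        using cancel[of "?p i"] p[of i] by linarith
      finally show ?thesis .
    qed
    have "(1 + (norm \<xi>)\<^sup>2) powr \<beta> \<le> (h powr (-2) * (\<Prod>i\<in>UNIV. ?p i)) powr \<beta>"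
      using one_plus_sum_le_prod[OF h, of \<xi>] \<open>0 \<le> \<beta>\<close> by (intro powr_mono2) auto
    also have "\<dots> = h powr (- 2 * \<beta>) * (\<Prod>i\<in>UNIV. ?p i powr \<beta>)"
      using h by (simp add: UNIV_2 powr_mult powr_powr)
    finally have "(1 + (norm \<xi>)\<^sup>2) powr \<beta> * (cmod (fourier (bump k a h c) \<xi>))\<^sup>2 \<le>
      h powr (- 2 * \<beta>) * (\<Prod>i\<in>UNIV. ?p i powr \<beta>) * (cmod (fourier (bump k a h c) \<xi>))\<^sup>2"
      by (rule mult_right_mono) auto
    also have "\<dots> = a\<^sup>2 * h powr (- 2 * \<beta>) * (\<Prod>i\<in>UNIV. ?p i powr \<beta> * (h * cmod (fourier1 (bspline k) (h * \<xi> $ i)))\<^sup>2)"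
      unfolding F by (simp add: power_mult_distrib prod.distrib prod_power_distrib)
    also have "\<dots> \<le> a\<^sup>2 * h powr (- 2 * \<beta>) * (\<Prod>i\<in>UNIV. h\<^sup>2 * ?m * (1 / ?p i))"
      by (intro mult_left_mono prod_mono conjI factor) auto
    finally show ?thesis .
  qed
  have "(\<integral>\<^sup>+\<xi>. ennreal ((1 + (norm \<xi>)\<^sup>2) powr \<beta> * (cmod (fourier (bump k a h c) \<xi>))\<^sup>2) \<partial>lborel)
    \<le> (\<integral>\<^sup>+\<xi>. ennreal (a\<^sup>2 * h powr (- 2 * \<beta>)) * (\<Prod>i\<in>UNIV. ennreal (h\<^sup>2 * ?m * (1 / (1 + (h * \<xi> $ i)\<^sup>2)))) \<partial>(lborel :: (real^2) measure))"
  proof (rule nn_integral_mono)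
    fix \<xi> :: "real^2"
    have "ennreal (a\<^sup>2 * h powr (- 2 * \<beta>)) * (\<Prod>i\<in>UNIV. ennreal (h\<^sup>2 * ?m * (1 / (1 + (h * \<xi> $ i)\<^sup>2)))) =
      ennreal (a\<^sup>2 * h powr (- 2 * \<beta>) * (\<Prod>i\<in>UNIV. h\<^sup>2 * ?m * (1 / (1 + (h * \<xi> $ i)\<^sup>2))))"
      by (subst prod_ennreal) (auto simp: ennreal_mult' prod_nonneg)
    then show "ennreal ((1 + (norm \<xi>)\<^sup>2) powr \<beta> * (cmod (fourier (bump k a h c) \<xi>))\<^sup>2) \<le>
      ennreal (a\<^sup>2 * h powr (- 2 * \<beta>)) * (\<Prod>i\<in>UNIV. ennreal (h\<^sup>2 * ?m * (1 / (1 + (h * \<xi> $ i)\<^sup>2))))"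
      using le[of \<xi>] by (simp only: ennreal_leI)
  qed
  also have "\<dots> = ennreal (a\<^sup>2 * h powr (- 2 * \<beta>)) * (\<Prod>i\<in>(UNIV::2 set). \<integral>\<^sup>+t. ennreal (h\<^sup>2 * ?m * (1 / (1 + (h * t)\<^sup>2))) \<partial>lborel)"
    by (subst nn_integral_cmult, measurable)
      (subst nn_integral_prod_cart[where F="\<lambda>_ t. ennreal (h\<^sup>2 * ?m * (1 / (1 + (h * t)\<^sup>2)))"], auto)
  also have "(\<integral>\<^sup>+t. ennreal (h\<^sup>2 * ?m * (1 / (1 + (h * t)\<^sup>2))) \<partial>lborel) = ennreal (h * ?m * pi)"
  proof -
    have "(\<integral>\<^sup>+t. ennreal (h\<^sup>2 * ?m * (1 / (1 + (h * t)\<^sup>2))) \<partial>lborel) = (\<integral>\<^sup>+t. ennreal (h\<^sup>2 * ?m) * ennreal (1 / (1 + (h * t)\<^sup>2)) \<partial>lborel)"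
      by (intro nn_integral_cong ennreal_mult') auto
    also have "\<dots> = ennreal (h\<^sup>2 * ?m) * ennreal (pi / h)"
      using h by (subst nn_integral_cmult) (simp_all only: nn_integral_cauchy, measurable)
    also have "\<dots> = ennreal (h * ?m * pi)"
      using h by (subst ennreal_mult'[symmetric]) (auto simp: power2_eq_square field_simps)
    finally show ?thesis .
  qed
  also have "(\<Prod>i\<in>(UNIV::2 set). ennreal (h * ?m * pi)) = ennreal ((h * ?m * pi)\<^sup>2)"
    using h by (subst prod_constant, subst ennreal_power) auto
  also have "ennreal (a\<^sup>2 * h powr (- 2 * \<beta>)) * ennreal ((h * ?m * pi)\<^sup>2) =
     ennreal (a\<^sup>2 * h powr (- 2 * \<beta>) * (h * ?m * pi)\<^sup>2)"
    by (rule ennreal_mult'[symmetric]) simp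
  also have "a\<^sup>2 * h powr (- 2 * \<beta>) * (h * ?m * pi)\<^sup>2 = (?m * pi)\<^sup>2 * a\<^sup>2 * h powr (2 - 2 * \<beta>)"
  proof -
    have "h powr (2 - 2 * \<beta>) = h\<^sup>2 * h powr (- 2 * \<beta>)"
      using h powr_add[of h 2 "- 2 * \<beta>"] by (simp add: powr_numeral)
    then show ?thesis by (simp add: power_mult_distrib)
  qed
  finally show ?thesis .
qed

lemma continuous_bump:
  assumes "0 < k" "0 < h"
  shows "continuous_on UNIV (bump k a h c)"
proof -
  have "continuous_on UNIV (\<lambda>x. bspline k ((x $ i - c $ i) / h))" for i
    using assms by (intro continuous_on_compose2[OF continuous_bspline]) (auto intro!: continuous_intros)
  then show ?thesis
    unfolding bump_def by (intro continuous_intros)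
qed

lemma abs_bump_le:
  assumes "0 \<le> a"
  shows "\<bar>bump k a h c x\<bar> \<le> a * 4 ^ k"
proof -
  have "\<bar>\<Prod>i\<in>UNIV. bspline k ((x $ i - c $ i) / h)\<bar> \<le> (\<Prod>i\<in>(UNIV::2 set). 2 ^ k)"
    unfolding abs_prod by (intro prod_mono) (auto simp: abs_bspline_le)
  also have "\<dots> = 4 ^ k" by (simp add: power2_eq_square flip: power_mult_distrib)
  finally show ?thesis
    using assms by (simp add: bump_def abs_mult mult_left_mono)
qed

lemma bump_eq_0:
  assumes "0 < h" "(real k + 1) * h < \<bar>x $ i - c $ i\<bar>"
  shows "bump k a h c x = 0"
proof -
  have "bspline k ((x $ i - c $ i) / h) = 0"
    using assms by (intro bspline_support) (simp add: field_simps)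
  then have "(\<Prod>i\<in>UNIV. bspline k ((x $ i - c $ i) / h)) = 0"
    by (intro prod_zero) auto
  then show ?thesis by (simp add: bump_def)
qed

text \<open>The three constants are fixed before the point, the width and the height, so they can
  enter the choice of the height in the lower bound.\<close>

lemma sobolev_bump_exists:
  assumes "0 \<le> \<beta>"
  obtains R B C :: real where "0 < R" "0 < B" "0 < C"
    "\<forall>x\<^sub>0 h a. 0 < h \<longrightarrow> h \<le> 1 \<longrightarrow> 0 \<le> a \<longrightarrow>
      (\<exists>f :: real^2 \<Rightarrow> real. continuous_on UNIV f \<and> f x\<^sub>0 = a \<and> (\<forall>x. \<bar>f x\<bar> \<le> B * a) \<and>
        (\<forall>x. R * h < norm (x - x\<^sub>0) \<longrightarrow> f x = 0) \<and>
        (\<integral>\<^sup>+\<xi>. ennreal ((1 + (norm \<xi>)\<^sup>2) powr \<beta> * (cmod (fourier f \<xi>))\<^sup>2) \<partial>lborel)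
          \<le> ennreal (C * a\<^sup>2 * h powr (2 - 2 * \<beta>)))"
proof -
  \<comment> \<open>The ceiling gives \<open>\<beta> \<le> real k\<close>; the successor makes the
    order positive, since the spline of order 0 has jumps.\<close>
  define k where "k = Suc (nat \<lceil>\<beta>\<rceil>)"
  have k: "0 < k" "\<beta> \<le> real k" unfolding k_def by linarith+
  obtain t where t: "0 < bspline k t" by (rule bspline_pos)
  define b where "b = (bspline k t)\<^sup>2"
  have b: "0 < b" using t by (simp add: b_def)
  show thesis
  \<comment> \<open>On the support each coordinate of \<open>x - x\<^sub>0\<close> is at most
    \<open>(k + 1 + \<bar>t\<bar>) * h\<close>, and the norm is at most the sum of the two
    coordinates, hence the factor 2. Division by \<open>b\<close> in the other constants comes from
    normalising the value at \<open>x\<^sub>0\<close>.\<close>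
  proof (rule that[of "2 * (real k + 1 + \<bar>t\<bar>)" "4 ^ k / b" "(8 ^ Suc k * pi)\<^sup>2 / b\<^sup>2"], goal_cases)
    case 4
    show ?case
    proof (intro allI impI)
      fix x\<^sub>0 :: "real^2" and h a :: real
      assume h: "0 < h" "h \<le> 1" and a: "0 \<le> a"
      \<comment> \<open>With this shift both rescaled coordinates of \<open>x\<^sub>0\<close> equal
        \<open>t\<close>, so the product of splines there is \<open>b\<close>.\<close>
      define c where "c = (\<chi> i. x\<^sub>0 $ i - h * t)"
      define f where "f = bump k (a / b) h c"
      show "\<exists>f :: real^2 \<Rightarrow> real. continuous_on UNIV f \<and> f x\<^sub>0 = a \<and> (\<forall>x. \<bar>f x\<bar> \<le> 4 ^ k / b * a) \<and>
          (\<forall>x. 2 * (real k + 1 + \<bar>t\<bar>) * h < norm (x - x\<^sub>0) \<longrightarrow> f x = 0) \<and>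
          (\<integral>\<^sup>+\<xi>. ennreal ((1 + (norm \<xi>)\<^sup>2) powr \<beta> * (cmod (fourier f \<xi>))\<^sup>2) \<partial>lborel)
            \<le> ennreal ((8 ^ Suc k * pi)\<^sup>2 / b\<^sup>2 * a\<^sup>2 * h powr (2 - 2 * \<beta>))"
      proof (intro exI[of _ f] conjI allI impI)
        show "continuous_on UNIV f" unfolding f_def using k h by (intro continuous_bump)
        show "f x\<^sub>0 = a"
          using h b by (simp add: f_def bump_def c_def b_def)
        show "\<bar>f x\<bar> \<le> 4 ^ k / b * a" for x
          using abs_bump_le[of "a / b" k h c x] a b by (simp add: f_def mult_ac)
        show "(\<integral>\<^sup>+\<xi>. ennreal ((1 + (norm \<xi>)\<^sup>2) powr \<beta> * (cmod (fourier f \<xi>))\<^sup>2) \<partial>lborel)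
            \<le> ennreal ((8 ^ Suc k * pi)\<^sup>2 / b\<^sup>2 * a\<^sup>2 * h powr (2 - 2 * \<beta>))"
          using bump_sobolev_norm[OF h k(2) assms, of "a / b" c] by (simp add: f_def power_divide mult_ac)
      next
        fix x assume x: "2 * (real k + 1 + \<bar>t\<bar>) * h < norm (x - x\<^sub>0)"
        have "\<exists>i. (real k + 1) * h < \<bar>x $ i - c $ i\<bar>"
        proof (rule ccontr)
          assume "\<nexists>i. (real k + 1) * h < \<bar>x $ i - c $ i\<bar>"
          then have *: "\<bar>x $ i - c $ i\<bar> \<le> (real k + 1) * h" for i by (auto simp: not_less)
          have "\<bar>(x - x\<^sub>0) $ i\<bar> \<le> (real k + 1 + \<bar>t\<bar>) * h" for i
          proof -
            have "\<bar>(x - x\<^sub>0) $ i\<bar> \<le> \<bar>x $ i - c $ i\<bar> + \<bar>h * t\<bar>"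
              by (simp add: c_def)
            also have "\<dots> \<le> (real k + 1) * h + h * \<bar>t\<bar>"
              using *[of i] h by (simp add: abs_mult)
            finally show ?thesis by (simp add: algebra_simps)
          qed
          then have "(\<Sum>i\<in>UNIV. \<bar>(x - x\<^sub>0) $ i\<bar>) \<le> (\<Sum>i\<in>(UNIV::2 set). (real k + 1 + \<bar>t\<bar>) * h)"
            by (intro sum_mono)
          with x norm_le_l1_cart[of "x - x\<^sub>0"] show False by (simp add: algebra_simps)
        qed
        then show "f x = 0" using h bump_eq_0 by (auto simp: f_def)
      qed
    qed
  qed (use b in auto)
qed

section \<open>The exponential Radon transform of a bump\<close>

lemma perp_eq: "perp \<theta> = (- (\<theta> $ 2)) *\<^sub>R axis 1 1 + (\<theta> $ 1) *\<^sub>R axis 2 1"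
  by (simp add: perp_def vec_eq_iff forall_2 axis_def)

lemma inner_perp: "\<theta> \<bullet> perp \<theta> = 0" "perp \<theta> \<bullet> perp \<theta> = \<theta> \<bullet> \<theta>"
  by (simp_all add: perp_def inner_vec_def sum_2)

lemma measurable_perp [measurable]: "perp \<in> borel_measurable borel"
  unfolding perp_eq[abs_def] by measurable

text \<open>In the orthonormal frame of \<open>\<theta>\<close> and \<open>perp \<theta>\<close>, a
  line meets the disc of radius \<open>r\<close> only when \<open>s\<close> is within
  \<open>r\<close> of \<open>\<theta> \<bullet> x\<^sub>0\<close>, and then in a parameter interval
  of length at most \<open>2 * r\<close>. The disc lies in the unit disc, so
  \<open>\<bar>t\<bar> \<le> 1\<close> there and the exponential weight is at most
  \<open>exp \<bar>\<mu>\<bar>\<close>.\<close>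

lemma abs_exp_radon_le:
  assumes \<theta>: "norm \<theta> = 1" and A: "\<And>x. \<bar>f x\<bar> \<le> A"
    and supp: "\<And>x. r < norm (x - x\<^sub>0) \<Longrightarrow> f x = 0" and r: "0 \<le> r" "norm x\<^sub>0 + r \<le> 1"
  shows "\<bar>exp_radon \<mu> f (\<theta>, s)\<bar> \<le> 2 * r * exp \<bar>\<mu>\<bar> * A * indicator {s. \<bar>s - \<theta> \<bullet> x\<^sub>0\<bar> \<le> r} s"
proof -
  let ?x = "\<lambda>t. s *\<^sub>R \<theta> + t *\<^sub>R perp \<theta>"
  define F where "F t = exp (\<mu> * (?x t \<bullet> perp \<theta>)) * f (?x t)" for t
  define m where "m = perp \<theta> \<bullet> x\<^sub>0"
  have A0: "0 \<le> A" using A[of 0] by linarith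
  have p1: "norm (perp \<theta>) = 1" using \<theta> by (simp add: norm_eq_sqrt_inner inner_perp)
  have xt: "?x t \<bullet> perp \<theta> = t" "?x t \<bullet> \<theta> = s" for t
    using \<theta> inner_perp[of \<theta>] by (simp_all add: inner_add_left inner_commute[of "perp \<theta>" \<theta>] norm_eq_1)
  have bound: "\<bar>F t\<bar> \<le> exp \<bar>\<mu>\<bar> * A * indicator {s. \<bar>s - \<theta> \<bullet> x\<^sub>0\<bar> \<le> r} s * indicator {m - r..m + r} t" for t
  proof (cases "f (?x t) = 0")
    case False
    then have n: "norm (?x t - x\<^sub>0) \<le> r" using supp[of "?x t"] by fastforce
    have "\<bar>(?x t - x\<^sub>0) \<bullet> \<theta>\<bar> \<le> r" "\<bar>(?x t - x\<^sub>0) \<bullet> perp \<theta>\<bar> \<le> r"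
      using Cauchy_Schwarz_ineq2[of "?x t - x\<^sub>0" \<theta>] Cauchy_Schwarz_ineq2[of "?x t - x\<^sub>0" "perp \<theta>"] n \<theta> p1
      by auto
    then have i: "\<bar>s - \<theta> \<bullet> x\<^sub>0\<bar> \<le> r" "\<bar>t - m\<bar> \<le> r"
      unfolding inner_diff_left xt by (auto simp: m_def inner_commute)
    have "\<bar>t\<bar> \<le> norm (?x t)"
      using Cauchy_Schwarz_ineq2[of "?x t" "perp \<theta>"] p1 xt by simp
    also have "\<dots> \<le> norm (?x t - x\<^sub>0) + norm x\<^sub>0"
      by (metis norm_triangle_sub add.commute)
    finally have "\<bar>t\<bar> \<le> 1" using n r by linarith
    then have "\<bar>\<mu> * t\<bar> \<le> \<bar>\<mu>\<bar> * 1"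
      unfolding abs_mult by (intro mult_left_mono) auto
    then have "exp (\<mu> * t) \<le> exp \<bar>\<mu>\<bar>" by simp
    then have "\<bar>F t\<bar> \<le> exp \<bar>\<mu>\<bar> * A"
      unfolding F_def xt abs_mult by (intro mult_mono A) auto
    with i show ?thesis by (auto simp: indicator_def)
  qed (use A0 in \<open>auto simp: F_def indicator_def\<close>)
  have eq: "exp_radon \<mu> f (\<theta>, s) = (\<integral>t. F t \<partial>lborel)"
    by (simp add: exp_radon_def F_def Let_def)
  show ?thesis
  proof (cases "integrable lborel F")
    case True
    have "\<bar>\<integral>t. F t \<partial>lborel\<bar> \<le> (\<integral>t. \<bar>F t\<bar> \<partial>lborel)"
      by (rule integral_abs_bound)
    also have "\<dots> \<le> (\<integral>t. exp \<bar>\<mu>\<bar> * A * indicator {s. \<bar>s - \<theta> \<bullet> x\<^sub>0\<bar> \<le> r} s * indicator {m - r..m + r} t \<partial>lborel)"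
      using True by (intro integral_mono integrable_abs integrable_mult_right integrable_real_indicator bound)
        (auto simp: emeasure_lborel_Icc_eq)
    also have "\<dots> = 2 * r * exp \<bar>\<mu>\<bar> * A * indicator {s. \<bar>s - \<theta> \<bullet> x\<^sub>0\<bar> \<le> r} s"
      using r by simp
    finally show ?thesis by (simp add: eq)
  next
    \<comment> \<open>A Bochner integral that does not exist is 0 by convention, and the right side
      is nonnegative.\<close>
    case False
    then show ?thesis using r A0 by (simp add: eq not_integrable_integral_eq)
  qed
qed

section \<open>Measurability and strips on the cylinder \<open>Z\<close>\<close>

lemma sets_circle_measure [measurable_cong]: "sets circle_measure = sets (restrict_space borel (sphere 0 1))"
  by (simp add: circle_measure_def)

lemma sets_Z_measure [measurable_cong]:
  "sets Z_measure = sets (restrict_space borel (sphere 0 1) \<Otimes>\<^sub>M restrict_space borel {-1..1})"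
  unfolding Z_measure_def by (intro sets_pair_measure_cong sets_circle_measure sets_restrict_space_cong) simp

lemma space_Z_measure: "space Z_measure = sphere 0 1 \<times> {-1..1}"
  by (simp add: sets_eq_imp_space_eq[OF sets_Z_measure] space_pair_measure space_restrict_space)

lemma measurable_Z_fst [measurable]: "fst \<in> measurable Z_measure borel"
  and measurable_Z_snd [measurable]: "snd \<in> measurable Z_measure borel"
proof -
  have 1: "(\<lambda>x. x) \<in> measurable (restrict_space borel A) borel" for A :: "'c::topological_space set"
    by (rule measurable_restrict_space1) simp
  show "fst \<in> measurable Z_measure borel"
    by (rule measurable_compose[OF _ 1, of fst Z_measure "sphere 0 1"]) measurable
  show "snd \<in> measurable Z_measure borel"
    by (rule measurable_compose[OF _ 1, of snd Z_measure "{-1..1}"]) measurable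
qed

lemma measurable_exp_radon:
  assumes [measurable]: "f \<in> borel_measurable borel"
  shows "exp_radon \<mu> f \<in> borel_measurable Z_measure"
proof -
  have "exp_radon \<mu> f = (\<lambda>z. \<integral>t. exp (\<mu> * ((snd z *\<^sub>R fst z + t *\<^sub>R perp (fst z)) \<bullet> perp (fst z))) *
      f (snd z *\<^sub>R fst z + t *\<^sub>R perp (fst z)) \<partial>lborel)"
    by (auto simp: exp_radon_def Let_def split: prod.splits)
  also have "\<dots> \<in> borel_measurable Z_measure"
    by (rule lborel.borel_measurable_lebesgue_integral) measurable
  finally show ?thesis .
qed

lemma emeasure_circle_measure: "emeasure circle_measure (space circle_measure) = ennreal (2 * pi)"
proof -
  have v: "(vector [cos \<phi>, sin \<phi>] :: real^2) = cos \<phi> *\<^sub>R axis 1 1 + sin \<phi> *\<^sub>R axis 2 1" for \<phi>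
    by (simp add: vec_eq_iff forall_2 axis_def)
  have "(\<lambda>\<phi>. vector [cos \<phi>, sin \<phi>] :: real^2) \<in> measurable (restrict_space lborel {0..<2 * pi}) borel"
    unfolding v by (rule measurable_restrict_space1) measurable
  then have "(\<lambda>\<phi>. vector [cos \<phi>, sin \<phi>] :: real^2) \<in> measurable (restrict_space lborel {0..<2 * pi}) (restrict_space borel (sphere 0 1))"
    by (intro measurable_restrict_space2)
       (auto simp: norm_eq_sqrt_inner inner_vec_def sum_2 simp flip: power2_eq_square)
  note c = this
  have "(\<lambda>\<phi>. vector [cos \<phi>, sin \<phi>] :: real^2) -` space (restrict_space borel (sphere 0 1)) \<inter>
      space (restrict_space lborel {0..<2 * pi}) = space (restrict_space lborel {0..<2 * pi})"
    using measurable_space[OF c] by auto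
  then show ?thesis
    unfolding circle_measure_def space_distr
    by (subst emeasure_distr[OF c sets.top]) (simp add: space_restrict_space emeasure_restrict_space)
qed

text \<open>In every direction the admissible \<open>s\<close> lie in an interval of length
  \<open>2 * r\<close>, and the directions have total measure \<open>2 * pi\<close>. Clipping to
  \<open>[-1, 1]\<close> can only decrease the integral.\<close>

lemma nn_integral_strip:
  assumes r: "0 \<le> r" and K: "0 \<le> K"
  shows "(\<integral>\<^sup>+z. ennreal (K * indicator {z. \<bar>snd z - fst z \<bullet> x\<^sub>0\<bar> \<le> r} z) \<partial>Z_measure) \<le> ennreal (4 * pi * r * K)"
proof -
  interpret R: finite_measure "restrict_space lborel {-1..1::real}"
    by (rule finite_measureI) (simp add: space_restrict_space emeasure_restrict_space)
  let ?g = "\<lambda>z. ennreal (K * indicator {z. \<bar>snd z - fst z \<bullet> x\<^sub>0\<bar> \<le> r} z)"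
  have "?g \<in> borel_measurable Z_measure" by measurable
  then have "(\<integral>\<^sup>+z. ?g z \<partial>Z_measure) = (\<integral>\<^sup>+\<theta>. \<integral>\<^sup>+s. ?g (\<theta>, s) \<partial>restrict_space lborel {-1..1} \<partial>circle_measure)"
    unfolding Z_measure_def by (rule R.nn_integral_fst[symmetric])
  also have "\<dots> \<le> (\<integral>\<^sup>+\<theta>. ennreal (2 * r * K) \<partial>circle_measure)"
  proof (rule nn_integral_mono)
    fix \<theta>
    have "(\<integral>\<^sup>+s. ?g (\<theta>, s) \<partial>restrict_space lborel {-1..1}) = (\<integral>\<^sup>+s. ?g (\<theta>, s) * indicator {-1..1} s \<partial>lborel)"
      by (rule nn_integral_restrict_space) auto
    also have "\<dots> \<le> (\<integral>\<^sup>+s. ennreal K * indicator {\<theta> \<bullet> x\<^sub>0 - r..\<theta> \<bullet> x\<^sub>0 + r} s \<partial>lborel)"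
      by (intro nn_integral_mono) (auto simp: indicator_def)
    also have "\<dots> = ennreal (2 * r * K)"
      using r K by (subst nn_integral_cmult_indicator) (auto simp flip: ennreal_mult' simp: mult_ac)
    finally show "(\<integral>\<^sup>+s. ?g (\<theta>, s) \<partial>restrict_space lborel {-1..1}) \<le> ennreal (2 * r * K)" .
  qed
  also have "\<dots> = ennreal (2 * r * K) * ennreal (2 * pi)"
    by (simp only: nn_integral_const emeasure_circle_measure)
  also have "\<dots> = ennreal (4 * pi * r * K)"
    using r K by (subst ennreal_mult'[symmetric]) (auto simp: mult_ac)
  finally show ?thesis .
qed

section \<open>The lower bound\<close>

theorem theorem5:
  fixes \<beta> L \<mu> \<sigma> I\<^sub>0 v\<^sub>0 C\<^sub>3 :: real
    and x\<^sub>0 :: "real^2"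
    and M :: "'a measure"
    and X :: "nat \<Rightarrow> 'a \<Rightarrow> (real^2) \<times> real"
    and \<epsilon> :: "nat \<Rightarrow> 'a \<Rightarrow> real"
    and G :: "real measure"
  assumes "\<beta> > 1" and "L > 0"
    and x0: "norm x\<^sub>0 < 1"
    and M: "prob_space M"
    and design: "iid M Z_measure X"
    and errors: "iid M borel \<epsilon>" "\<And>i. distr M borel (\<epsilon> i) = G"
    and indep: "indep_sequences M Z_measure X borel \<epsilon>"
    and moments: "\<And>i. integrable M (\<lambda>\<omega>. (\<epsilon> i \<omega>)\<^sup>2)" "\<And>i. (\<integral>\<omega>. \<epsilon> i \<omega> \<partial>M) = 0"
      "\<And>i. (\<integral>\<omega>. (\<epsilon> i \<omega>)\<^sup>2 \<partial>M) = \<sigma>\<^sup>2" "\<sigma>\<^sup>2 > 0"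
    and B1: "I\<^sub>0 > 0" "v\<^sub>0 > 0"
      "\<And>v. \<bar>v\<bar> \<le> v\<^sub>0 \<Longrightarrow> kullback G (distr G borel (\<lambda>u. u - v)) \<le> ereal (I\<^sub>0 * v\<^sup>2)"
    and B2: "\<And>n g. g \<in> borel_measurable Z_measure \<Longrightarrow> (\<And>z. 0 \<le> g z) \<Longrightarrow>
      (\<integral>\<^sup>+\<omega>. (\<Sum>i<n. ennreal (g (X i \<omega>))) \<partial>M)
        \<le> ennreal C\<^sub>3 * of_nat n * (\<integral>\<^sup>+z. ennreal (g z) \<partial>Z_measure)"
  shows "\<exists>c\<^sub>0::real. c\<^sub>0 > 0 \<and>
    ennreal c\<^sub>0 \<le> liminf (\<lambda>n. INF est\<in>estimators n. SUP f\<in>sobolev_class \<beta> L.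
      ennreal (1 / (rate \<beta> n)\<^sup>2) * MSE M \<mu> X \<epsilon> x\<^sub>0 n est f)"
proof -
  interpret prob_space M by fact
  have X[measurable]: "X i \<in> measurable M Z_measure" for i
    using design by (auto simp: iid_def indep_vars_def)
  have "0 \<le> \<beta>" using \<open>\<beta> > 1\<close> by simp
  then obtain R B C where R: "0 < R" and B: "0 < B" and C: "0 < C" and
    bumps: "\<forall>x\<^sub>0 h a. 0 < h \<longrightarrow> h \<le> 1 \<longrightarrow> 0 \<le> a \<longrightarrow>
      (\<exists>f :: real^2 \<Rightarrow> real. continuous_on UNIV f \<and> f x\<^sub>0 = a \<and> (\<forall>x. \<bar>f x\<bar> \<le> B * a) \<and>
        (\<forall>x. R * h < norm (x - x\<^sub>0) \<longrightarrow> f x = 0) \<and>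
        (\<integral>\<^sup>+\<xi>. ennreal ((1 + (norm \<xi>)\<^sup>2) powr \<beta> * (cmod (fourier f \<xi>))\<^sup>2) \<partial>lborel)
          \<le> ennreal (C * a\<^sup>2 * h powr (2 - 2 * \<beta>)))"
    by (rule sobolev_bump_exists)
  \<comment> \<open>\<open>D * h * a\<close> will bound the transform of a bump of width
    \<open>h\<close> and height \<open>a\<close>, and \<open>E * \<kappa>\<^sup>2\<close> the mean
    Kullback sum. The sign of \<open>C\<^sub>3\<close> is not prescribed, hence the absolute
    value.\<close>
  define D where "D = 2 * R * exp \<bar>\<mu>\<bar> * B"
  define E where "E = I\<^sub>0 * \<bar>C\<^sub>3\<bar> * (4 * pi * R * D\<^sup>2)"
  have D: "0 < D" using R B by (simp add: D_def)
  have E: "0 \<le> E" using R B1(1) by (simp add: E_def)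
  \<comment> \<open>The bounds serve, in turn, \<open>\<kappa>\<^sup>2 \<le> \<kappa>\<close>,
    membership in the class, the range of (B1), and a mean Kullback sum of at most 1/2. The first
    lets bounds linear in \<open>\<kappa>\<close> control quantities quadratic in it, and
    \<open>E + 1\<close> avoids a zero denominator.\<close>
  define \<kappa> where "\<kappa> = min (min 1 (L / C)) (min (v\<^sub>0 / D) (1 / (2 * (E + 1))))"
  have \<kappa>: "0 < \<kappa>" "\<kappa> \<le> 1" "\<kappa> \<le> L / C" "\<kappa> \<le> v\<^sub>0 / D" "\<kappa> \<le> 1 / (2 * (E + 1))"
    using \<open>L > 0\<close> B1(2) C D E by (auto simp: \<kappa>_def)
  have \<kappa>2: "\<kappa>\<^sup>2 \<le> \<kappa>" using \<kappa> by (simp add: power2_eq_square mult_left_le)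
  have \<kappa>L: "C * \<kappa>\<^sup>2 \<le> L"
  proof -
    have "C * \<kappa>\<^sup>2 \<le> C * \<kappa>" using \<kappa>2 C by (intro mult_left_mono) auto
    also have "\<dots> \<le> L" using \<kappa>(3) C by (simp add: pos_le_divide_eq mult.commute)
    finally show ?thesis .
  qed
  have \<kappa>D: "D * \<kappa> \<le> v\<^sub>0"
    using \<kappa>(4) D by (simp add: pos_le_divide_eq mult.commute)
  have \<kappa>E: "E * \<kappa>\<^sup>2 \<le> 1 / 2"
  proof -
    have "E * \<kappa>\<^sup>2 \<le> (E + 1) * \<kappa>" using \<kappa>2 \<kappa>(1) E by (intro mult_mono) auto
    also have "\<dots> \<le> 1 / 2" using \<kappa>(5) E by (simp add: field_simps)
    finally show ?thesis .
  qed
  define h where "h n = real n powr (- (1 / (2 * \<beta> + 1)))" for n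
  have "h \<longlonglongrightarrow> 0"
    unfolding h_def using \<open>\<beta> > 1\<close>
    by (intro tendsto_neg_powr filterlim_real_sequentially) auto
  then have "(\<lambda>n. norm x\<^sub>0 + R * h n) \<longlonglongrightarrow> norm x\<^sub>0 + R * 0"
    by (intro tendsto_intros)
  then have ev: "\<forall>\<^sub>F n in sequentially. norm x\<^sub>0 + R * h n < 1"
    using x0 by (intro order_tendstoD) auto
  \<comment> \<open>The sum of the two risks is at least \<open>a\<^sup>2 / 4\<close>, that is
    \<open>\<kappa>\<^sup>2 / 4\<close> after normalisation by the rate, and the supremum is at
    least half of the sum. For \<open>n = 0\<close> both \<open>h\<close> and the rate are 0 by the
    convention for powers of 0, so \<open>n\<close> starts at 1.\<close>
  have bound: "ennreal (\<kappa>\<^sup>2 / 8) \<le> (INF est\<in>estimators n. SUP f\<in>sobolev_class \<beta> L.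
      ennreal (1 / (rate \<beta> n)\<^sup>2) * MSE M \<mu> X \<epsilon> x\<^sub>0 n est f)"
    if n: "1 \<le> n" and inside: "norm x\<^sub>0 + R * h n < 1" for n
  proof (rule INF_greatest)
    fix est assume "est \<in> estimators n"
    then have est: "est \<in> borel_measurable (\<Pi>\<^sub>M i\<in>{..<n}. Z_measure \<Otimes>\<^sub>M borel)"
      by (simp add: estimators_def)
    have h: "0 < h n" using n by (simp add: h_def)
    have h1: "h n \<le> 1"
      using n \<open>\<beta> > 1\<close> powr_mono[of "- (1 / (2 * \<beta> + 1))" 0 "real n"] by (simp add: h_def)
    have rate: "rate \<beta> n = h n powr (\<beta> - 1)"
      unfolding rate_def h_def powr_powr by (simp add: field_simps)
    have r: "0 < rate \<beta> n" "rate \<beta> n \<le> 1"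
      using h h1 \<open>\<beta> > 1\<close> powr_mono2[of "\<beta> - 1" "h n" 1] by (simp_all add: rate)
    have rh: "(rate \<beta> n)\<^sup>2 * h n powr (2 - 2 * \<beta>) = 1"
      using h by (simp add: rate powr_power flip: powr_add)
    have nh: "real n * (h n * (h n * rate \<beta> n)\<^sup>2) = 1"
    proof -
      have "h n * rate \<beta> n = h n powr \<beta>"
        using h powr_mult_base[of "h n" "\<beta> - 1"] by (simp add: rate)
      then have "h n * (h n * rate \<beta> n)\<^sup>2 = h n * h n powr (2 * \<beta>)"
        by (simp add: power2_eq_square flip: powr_add)
      also have "\<dots> = h n powr (2 * \<beta> + 1)"
        using h powr_mult_base[of "h n" "2 * \<beta>"] by (simp add: add.commute)
      also have "\<dots> = real n powr (- 1)"
        unfolding h_def powr_powr using \<open>\<beta> > 1\<close> by (simp add: field_simps)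
      finally show ?thesis using n by (simp add: powr_minus_divide)
    qed
    define a where "a = \<kappa> * rate \<beta> n"
    have a: "0 < a" "a \<le> \<kappa>" using \<kappa> r by (simp_all add: a_def mult_left_le)
    obtain f where f: "continuous_on UNIV f" "f x\<^sub>0 = a" "\<And>x. \<bar>f x\<bar> \<le> B * a"
      "\<And>x. R * h n < norm (x - x\<^sub>0) \<Longrightarrow> f x = 0"
      "(\<integral>\<^sup>+\<xi>. ennreal ((1 + (norm \<xi>)\<^sup>2) powr \<beta> * (cmod (fourier f \<xi>))\<^sup>2) \<partial>lborel)
          \<le> ennreal (C * a\<^sup>2 * h n powr (2 - 2 * \<beta>))"
      using bumps[rule_format, OF h h1, of a x\<^sub>0] a by auto
    have f_in: "f \<in> sobolev_class \<beta> L"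
    proof -
      have "C * a\<^sup>2 * h n powr (2 - 2 * \<beta>) = C * \<kappa>\<^sup>2 * ((rate \<beta> n)\<^sup>2 * h n powr (2 - 2 * \<beta>))"
        by (simp add: a_def power_mult_distrib)
      also have "\<dots> \<le> L" using \<kappa>L rh by simp
      finally have "ennreal (C * a\<^sup>2 * h n powr (2 - 2 * \<beta>)) \<le> ennreal L" by (rule ennreal_leI)
      moreover have "f x = 0" if "x \<notin> cball 0 1" for x
        using that inside norm_triangle_sub[of x x\<^sub>0] by (intro f(4)) (auto simp: norm_minus_commute)
      ultimately show ?thesis using f(1,5) by (auto simp: sobolev_class_def)
    qed
    have zero_in: "(\<lambda>_. 0) \<in> sobolev_class \<beta> L"
      by (simp add: sobolev_class_def fourier_def)
    define T where "T = exp_radon \<mu> f"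
    have T[measurable]: "T \<in> borel_measurable Z_measure"
      unfolding T_def using f(1) by (intro measurable_exp_radon borel_measurable_continuous_onI)
    define S where "S = {z :: (real^2) \<times> real. \<bar>snd z - fst z \<bullet> x\<^sub>0\<bar> \<le> R * h n}"
    have T_le: "\<bar>T z\<bar> \<le> D * h n * a * indicator S z" if "z \<in> space Z_measure" for z
    proof -
      have "norm (fst z) = 1" using that by (auto simp: space_Z_measure)
      from abs_exp_radon_le[of "fst z" f "B * a" "R * h n" x\<^sub>0 \<mu> "snd z", OF this f(3,4)] show ?thesis
        using R h inside by (simp add: T_def S_def D_def indicator_def mult_ac)
    qed
    have T_le': "\<bar>T z\<bar> \<le> v\<^sub>0" if "z \<in> space Z_measure" for z
    proof -
      have "\<bar>T z\<bar> \<le> D * (h n * (a * indicator S z))"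
        using T_le[OF that] by (simp add: mult_ac)
      also have "\<dots> \<le> D * (1 * (\<kappa> * 1))"
        using D h h1 a \<kappa> by (intro mult_mono) (auto simp: indicator_def)
      finally show ?thesis using \<kappa>D by simp
    qed
    have small: "(\<integral>\<^sup>+\<omega>. (\<Sum>i<n. ennreal (I\<^sub>0 * (T (X i \<omega>))\<^sup>2)) \<partial>M) \<le> ennreal (1 / 2)"
    proof -
      let ?K = "I\<^sub>0 * (D * h n * a)\<^sup>2"
      let ?g = "\<lambda>z. ?K * indicator S z"
      have g: "?g \<in> borel_measurable Z_measure" unfolding S_def by measurable
      have "(\<integral>\<^sup>+\<omega>. (\<Sum>i<n. ennreal (I\<^sub>0 * (T (X i \<omega>))\<^sup>2)) \<partial>M) \<le> (\<integral>\<^sup>+\<omega>. (\<Sum>i<n. ennreal (?g (X i \<omega>))) \<partial>M)"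
      proof (intro nn_integral_mono sum_mono ennreal_leI)
        fix \<omega> i assume "\<omega> \<in> space M"
        then have "X i \<omega> \<in> space Z_measure" using X[of i] by (rule measurable_space[rotated])
        then have "\<bar>T (X i \<omega>)\<bar>\<^sup>2 \<le> (D * h n * a * indicator S (X i \<omega>))\<^sup>2"
          by (intro power_mono T_le) auto
        then have "I\<^sub>0 * \<bar>T (X i \<omega>)\<bar>\<^sup>2 \<le> I\<^sub>0 * (D * h n * a * indicator S (X i \<omega>))\<^sup>2"
          using B1(1) by (intro mult_left_mono) auto
        then show "I\<^sub>0 * (T (X i \<omega>))\<^sup>2 \<le> ?g (X i \<omega>)"
          by (cases "X i \<omega> \<in> S") simp_all
      qed
      also have "\<dots> \<le> ennreal C\<^sub>3 * of_nat n * (\<integral>\<^sup>+z. ennreal (?g z) \<partial>Z_measure)"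
        using B1(1) by (intro B2 g) auto
      \<comment> \<open>A negative \<open>C\<^sub>3\<close> is read as 0 by \<open>ennreal\<close>,
        so the absolute value is an upper bound in every case and the product can be computed in the
        reals.\<close>
      also have "\<dots> \<le> ennreal \<bar>C\<^sub>3\<bar> * ennreal (real n) * ennreal (4 * pi * (R * h n) * ?K)"
      proof (intro mult_mono)
        show "(\<integral>\<^sup>+z. ennreal (?g z) \<partial>Z_measure) \<le> ennreal (4 * pi * (R * h n) * ?K)"
          unfolding S_def using R h B1(1) by (intro nn_integral_strip) auto
      qed (auto simp: ennreal_of_nat_eq_real_of_nat ennreal_leI)
      also have "\<dots> = ennreal (\<bar>C\<^sub>3\<bar> * real n * (4 * pi * (R * h n) * ?K))"
        by (simp only: ennreal_mult'[of "\<bar>C\<^sub>3\<bar> * real n"] ennreal_mult'[of "\<bar>C\<^sub>3\<bar>"] abs_ge_zero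
            mult_nonneg_nonneg of_nat_0_le_iff)
      also have "\<bar>C\<^sub>3\<bar> * real n * (4 * pi * (R * h n) * ?K) = E * \<kappa>\<^sup>2 * (real n * (h n * (h n * rate \<beta> n)\<^sup>2))"
        by (simp add: E_def a_def power_mult_distrib)
      also have "\<dots> \<le> 1 / 2" using nh \<kappa>E by simp
      finally show ?thesis by (simp add: ennreal_leI)
    qed
    \<comment> \<open>The transform of the zero function vanishes, so its sample consists of the
      pairs of design point and error, as in the first risk of the two-point bound.\<close>
    have "ennreal (a\<^sup>2 / 4) \<le> MSE M \<mu> X \<epsilon> x\<^sub>0 n est (\<lambda>_. 0) + MSE M \<mu> X \<epsilon> x\<^sub>0 n est f"
      using regression_two_point[OF M X errors indep _ B1(1) B1(3) T T_le' small est, of a 0] n f(2)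
      by (simp add: MSE_def sample_of_def exp_radon_def T_def case_prod_beta)
    then have "ennreal (1 / (rate \<beta> n)\<^sup>2) * ennreal (a\<^sup>2 / 4) \<le> ennreal (1 / (rate \<beta> n)\<^sup>2) *
        (MSE M \<mu> X \<epsilon> x\<^sub>0 n est (\<lambda>_. 0) + MSE M \<mu> X \<epsilon> x\<^sub>0 n est f)"
      by (rule mult_left_mono) simp
    moreover have "ennreal (1 / (rate \<beta> n)\<^sup>2) * ennreal (a\<^sup>2 / 4) = 2 * ennreal (\<kappa>\<^sup>2 / 8)"
    proof -
      have "1 / (rate \<beta> n)\<^sup>2 * (a\<^sup>2 / 4) = 2 * (\<kappa>\<^sup>2 / 8)"
        using r by (simp add: a_def power_mult_distrib field_simps)
      then have "ennreal (1 / (rate \<beta> n)\<^sup>2) * ennreal (a\<^sup>2 / 4) = ennreal (2 * (\<kappa>\<^sup>2 / 8))"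
        by (subst ennreal_mult'[symmetric]) auto
      then show ?thesis by (subst (asm) ennreal_mult') auto
    qed
    ultimately have "2 * ennreal (\<kappa>\<^sup>2 / 8) \<le> ennreal (1 / (rate \<beta> n)\<^sup>2) * MSE M \<mu> X \<epsilon> x\<^sub>0 n est (\<lambda>_. 0) +
        ennreal (1 / (rate \<beta> n)\<^sup>2) * MSE M \<mu> X \<epsilon> x\<^sub>0 n est f"
      by (simp only: distrib_left)
    also have "\<dots> \<le> (SUP f\<in>sobolev_class \<beta> L. ennreal (1 / (rate \<beta> n)\<^sup>2) * MSE M \<mu> X \<epsilon> x\<^sub>0 n est f) +
        (SUP f\<in>sobolev_class \<beta> L. ennreal (1 / (rate \<beta> n)\<^sup>2) * MSE M \<mu> X \<epsilon> x\<^sub>0 n est f)"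
      by (intro add_mono SUP_upper zero_in f_in)
    finally show "ennreal (\<kappa>\<^sup>2 / 8) \<le> (SUP f\<in>sobolev_class \<beta> L. ennreal (1 / (rate \<beta> n)\<^sup>2) * MSE M \<mu> X \<epsilon> x\<^sub>0 n est f)"
      by (simp add: mult_2[symmetric] ennreal_mult_le_mult_iff)
  qed
  show ?thesis
  proof (intro exI[of _ "\<kappa>\<^sup>2 / 8"] conjI Liminf_bounded)
    show "\<forall>\<^sub>F n in sequentially. ennreal (\<kappa>\<^sup>2 / 8) \<le> (INF est\<in>estimators n. SUP f\<in>sobolev_class \<beta> L.
      ennreal (1 / (rate \<beta> n)\<^sup>2) * MSE M \<mu> X \<epsilon> x\<^sub>0 n est f)"
      using ev eventually_ge_at_top[of 1] by eventually_elim (rule bound)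
  qed (use \<kappa> in simp)
qed

end
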